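(* Let $\mathcal{C}$ be a Conway category and let $(\mathbf{Q},q)$ be an initialized finite automaton which is initially connected. If $\mathcal{C}$ satisfies the identity $\Gamma(\mathbf{Q},q)$, then $\mathcal{C}$ satisfies the group identity $\Gamma(G)$ for every finite simple group $G$ that divides the monoid $M(\mathbf{Q})$.
   Context: Cartesian categories have chosen finite products (terminal object $T$, projections $\pi_i$, tupling $\langle\cdot\rangle$, $!_A:A\to T$, $f\times g$), strictly associative; composition is written $g\circ f$; $\Delta_{A^n}=\langle 1_A,\ldots,1_A\rangle:A\to A^n$. A dagger operation maps $f:A\times C\to A$ to $f^\dagger:C\to A$. A Conway category is a cartesian category with dagger satisfying: $(f\circ(1_A\times g))^\dagger=f^\dagger\circ g$ ($f:A\times B\to A$, $g:C\to B$); $f^{\dagger\dagger}=(f\circ(\Delta_{A^2}\times 1_C))^\dagger$ ($f:A\times A\times C\to A$); $(f\circ\langle g,\pi_2^{A\times C}\rangle)^\dagger=f\circ\langle (g\circ\langle f,\pi_2^{B\times C}\rangle)^\dagger,1_C\rangle$ ($f:B\times C\to A$, $g:A\times C\to B$). A finite automaton $\mathbf{Q}=(Q,Z,\cdot)$ has finite nonempty state set $Q$, finite nonempty input alphabet $Z$ and action $Q\times Z\to Q$, extended to words; $M(\mathbf{Q})$ is the monoid of functions $Q\to Q$, $q\mapsto qu$, induced by words $u\in Z^*$. Write $Q=\{q_1,\ldots,q_n\}$, identified with $\{1,\ldots,n\}$, and $Z=\{a_1,\ldots,a_m\}$. For an object $A$ and $i\in[n]$ let $\rho_i^{\mathbf{Q},A}=\langle\pi^{A^n}_{ia_1},\ldots,\pi^{A^n}_{ia_m}\rangle:A^n\to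 A^m$ ($ia_j$ is the index of $q_i\cdot a_j$). For $f:A^m\times C\to A$ let $f^{\mathbf{Q},A}:A^n\times C\to A^n$ have components $\pi_i^{A^n}\circ f^{\mathbf{Q},A}=f\circ(\rho_i^{\mathbf{Q},A}\times 1_C)$. An initialized automaton $(\mathbf{Q},q_i)$ has a distinguished state; the identity $\Gamma(\mathbf{Q},q_i)$ holds in $\mathcal{C}$ if $\pi_i^{A^n}\circ(f^{\mathbf{Q},A})^\dagger=(f\circ(\Delta_{A^m}\times 1_C))^\dagger$ for all objects $A,C$ and all $f:A^m\times C\to A$. $(\mathbf{Q},q)$ is initially connected if every state equals $qu$ for some word $u$. For a finite group $G$, $\Gamma(G)$ is the identity $\Gamma(\mathbf{Q}_G)$ for the automaton $\mathbf{Q}_G=(G,G,\cdot)$ with action by multiplication, where $\Gamma(\mathbf{P})$ for an automaton $\mathbf{P}$ with $n$ states and $m$ letters means $(f^{\mathbf{P},A})^\dagger=\Delta_{A^n}\circ(f\circ(\Delta_{A^m}\times 1_C))^\dagger$ for all $f:A^m\times C\to A$. A group in a finite monoid $M$ is a subsemigroup which is a group; a finite group divides $M$ if it is a homomorphic image of a group in $M$. A finite group is simple if it is nontrivial and has no normal subgroups other than itself and the trivial one. *)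

theory Defs
  imports "HOL-Algebra.SimpleGroups" "HOL-Library.FuncSet"
begin

record ('o, 'm) dag_cat =
  ob    :: "'o set"
  ar    :: "'m set"
  src   :: "'m \<Rightarrow> 'o"
  tgt   :: "'m \<Rightarrow> 'o"
  cmp   :: "'m \<Rightarrow> 'm \<Rightarrow> 'm"          (* cmp g f = g \<circ> f *)
  ident :: "'o \<Rightarrow> 'm"
  trm   :: "'o"
  bang  :: "'o \<Rightarrow> 'm"
  prd   :: "'o \<Rightarrow> 'o \<Rightarrow> 'o"
  pi1   :: "'o \<Rightarrow> 'o \<Rightarrow> 'm"
  pi2   :: "'o \<Rightarrow> 'o \<Rightarrow> 'm"
  pair  :: "'m \<Rightarrow> 'm \<Rightarrow> 'm"
  dag   :: "'o \<Rightarrow> 'o \<Rightarrow> 'm \<Rightarrow> 'm"   (* dag A C f = f\<^sup>\<dagger> : C \<rightarrow> A for f : A \<times> C \<rightarrow> A *)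

definition homc :: "('o, 'm, 'x) dag_cat_scheme \<Rightarrow> 'm \<Rightarrow> 'o \<Rightarrow> 'o \<Rightarrow> bool" where
  "homc C f A B \<longleftrightarrow> f \<in> ar C \<and> src C f = A \<and> tgt C f = B"

definition cartesian_category :: "('o, 'm, 'x) dag_cat_scheme \<Rightarrow> bool" where
  "cartesian_category C \<longleftrightarrow>
     \<comment> \<open>category\<close>
     (\<forall>f \<in> ar C. src C f \<in> ob C \<and> tgt C f \<in> ob C) \<and>
     (\<forall>A \<in> ob C. homc C (ident C A) A A) \<and>
     (\<forall>f g A B D. homc C f A B \<longrightarrow> homc C g B D \<longrightarrow> homc C (cmp C g f) A D) \<and>
     (\<forall>f A B. homc C f A B \<longrightarrow> cmp C f (ident C A) = f \<and> cmp C (ident C B) f = f) \<and>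
     (\<forall>f g h A B D E. homc C f A B \<longrightarrow> homc C g B D \<longrightarrow> homc C h D E \<longrightarrow>
        cmp C h (cmp C g f) = cmp C (cmp C h g) f) \<and>
     \<comment> \<open>terminal object\<close>
     trm C \<in> ob C \<and>
     (\<forall>A \<in> ob C. homc C (bang C A) A (trm C) \<and> (\<forall>f. homc C f A (trm C) \<longrightarrow> f = bang C A)) \<and>
     \<comment> \<open>binary products\<close>
     (\<forall>A \<in> ob C. \<forall>B \<in> ob C.
        prd C A B \<in> ob C \<and>
        homc C (pi1 C A B) (prd C A B) A \<and> homc C (pi2 C A B) (prd C A B) B \<and>
        (\<forall>D f g. homc C f D A \<longrightarrow> homc C g D B \<longrightarrow>
           homc C (pair C f g) D (prd C A B) \<and>
           cmp C (pi1 C A B) (pair C f g) = f \<and> cmp C (pi2 C A B) (pair C f g) = g) \<and>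
        (\<forall>D h. homc C h D (prd C A B) \<longrightarrow>
           pair C (cmp C (pi1 C A B) h) (cmp C (pi2 C A B) h) = h)) \<and>
     \<comment> \<open>strict associativity: (A\<times>B)\<times>D = A\<times>(B\<times>D) and the associator is the identity\<close>
     (\<forall>A \<in> ob C. \<forall>B \<in> ob C. \<forall>D \<in> ob C.
        prd C (prd C A B) D = prd C A (prd C B D) \<and>
        pi1 C A (prd C B D) = cmp C (pi1 C A B) (pi1 C (prd C A B) D) \<and>
        cmp C (pi1 C B D) (pi2 C A (prd C B D)) = cmp C (pi2 C A B) (pi1 C (prd C A B) D) \<and>
        cmp C (pi2 C B D) (pi2 C A (prd C B D)) = pi2 C (prd C A B) D)"

definition cross :: "('o, 'm, 'x) dag_cat_scheme \<Rightarrow> 'm \<Rightarrow> 'm \<Rightarrow> 'm" where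
  "cross C f g = pair C (cmp C f (pi1 C (src C f) (src C g))) (cmp C g (pi2 C (src C f) (src C g)))"

fun pw :: "('o, 'm, 'x) dag_cat_scheme \<Rightarrow> 'o \<Rightarrow> nat \<Rightarrow> 'o" where
  "pw C A 0 = trm C"
| "pw C A (Suc 0) = A"
| "pw C A (Suc (Suc n)) = prd C A (pw C A (Suc n))"

text \<open>Projection \<open>\<pi>_i^{A^n} : A^n \<rightarrow> A\<close>, indices \<open>i\<close> are 0-based (\<open>i < n\<close>).\<close>
fun proj :: "('o, 'm, 'x) dag_cat_scheme \<Rightarrow> 'o \<Rightarrow> nat \<Rightarrow> nat \<Rightarrow> 'm" where
  "proj C A 0 i = undefined"
| "proj C A (Suc 0) i = ident C A"
| "proj C A (Suc (Suc n)) i =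
     (if i = 0 then pi1 C A (pw C A (Suc n))
      else cmp C (proj C A (Suc n) (i - 1)) (pi2 C A (pw C A (Suc n))))"

fun tup :: "('o, 'm, 'x) dag_cat_scheme \<Rightarrow> 'o \<Rightarrow> 'm list \<Rightarrow> 'm" where
  "tup C D [] = bang C D"
| "tup C D [f] = f"
| "tup C D (f # g # fs) = pair C f (tup C D (g # fs))"

definition diag :: "('o, 'm, 'x) dag_cat_scheme \<Rightarrow> 'o \<Rightarrow> nat \<Rightarrow> 'm" where
  "diag C A n = tup C A (replicate n (ident C A))"

definition conway_category :: "('o, 'm, 'x) dag_cat_scheme \<Rightarrow> bool" where
  "conway_category C \<longleftrightarrow> cartesian_category C \<and>
     \<comment> \<open>dagger typing\<close>
     (\<forall>A \<in> ob C. \<forall>D \<in> ob C. \<forall>f. homc C f (prd C A D) A \<longrightarrow> homc C (dag C A D f) D A) \<and>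
     \<comment> \<open>parameter identity\<close>
     (\<forall>A \<in> ob C. \<forall>B \<in> ob C. \<forall>D \<in> ob C. \<forall>f g. homc C f (prd C A B) A \<longrightarrow> homc C g D B \<longrightarrow>
        dag C A D (cmp C f (cross C (ident C A) g)) = cmp C (dag C A B f) g) \<and>
     \<comment> \<open>double dagger identity\<close>
     (\<forall>A \<in> ob C. \<forall>D \<in> ob C. \<forall>f. homc C f (prd C A (prd C A D)) A \<longrightarrow>
        dag C A D (dag C A (prd C A D) f) = dag C A D (cmp C f (cross C (diag C A 2) (ident C D)))) \<and>
     \<comment> \<open>composition identity\<close>
     (\<forall>A \<in> ob C. \<forall>B \<in> ob C. \<forall>D \<in> ob C. \<forall>f g. homc C f (prd C B D) A \<longrightarrow> homc C g (prd C A D) B \<longrightarrow>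
        dag C A D (cmp C f (pair C g (pi2 C A D))) =
        cmp C f (pair C (dag C B D (cmp C g (pair C f (pi2 C B D)))) (ident C D)))"

text \<open>An automaton with state set \<open>{0..<n}\<close>, input alphabet \<open>{0..<m}\<close> and action \<open>\<delta>\<close>
  (\<open>\<delta> i j\<close> is the index of \<open>q_i \<cdot> a_j\<close>).\<close>
definition automaton :: "nat \<Rightarrow> nat \<Rightarrow> (nat \<Rightarrow> nat \<Rightarrow> nat) \<Rightarrow> bool" where
  "automaton n m \<delta> \<longleftrightarrow> 0 < n \<and> 0 < m \<and> (\<forall>i < n. \<forall>j < m. \<delta> i j < n)"

definition run :: "(nat \<Rightarrow> nat \<Rightarrow> nat) \<Rightarrow> nat \<Rightarrow> nat list \<Rightarrow> nat" where
  "run \<delta> q u = foldl \<delta> q u"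

definition initially_connected :: "nat \<Rightarrow> nat \<Rightarrow> (nat \<Rightarrow> nat \<Rightarrow> nat) \<Rightarrow> nat \<Rightarrow> bool" where
  "initially_connected n m \<delta> q \<longleftrightarrow> (\<forall>p < n. \<exists>u. set u \<subseteq> {0..<m} \<and> run \<delta> q u = p)"

definition trans_monoid :: "nat \<Rightarrow> nat \<Rightarrow> (nat \<Rightarrow> nat \<Rightarrow> nat) \<Rightarrow> (nat \<Rightarrow> nat) set" where
  "trans_monoid n m \<delta> = {(\<lambda>p \<in> {0..<n}. run \<delta> p u) | u. set u \<subseteq> {0..<m}}"

text \<open>Product in \<open>M(Q)\<close>: the function of \<open>uv\<close> is "first \<open>u\<close>, then \<open>v\<close>".\<close>
definition tm_mult :: "nat \<Rightarrow> (nat \<Rightarrow> nat) \<Rightarrow> (nat \<Rightarrow> nat) \<Rightarrow> (nat \<Rightarrow> nat)" where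
  "tm_mult n f g = compose {0..<n} g f"

text \<open>A finite group \<open>G\<close> divides \<open>M(Q)\<close>: it is a homomorphic image of a group in \<open>M(Q)\<close>,
  i.e. of a subsemigroup \<open>H\<close> of \<open>M(Q)\<close> which is a group (with some identity \<open>e\<close>).\<close>
definition group_divides_tm ::
  "('g, 'b) monoid_scheme \<Rightarrow> nat \<Rightarrow> nat \<Rightarrow> (nat \<Rightarrow> nat \<Rightarrow> nat) \<Rightarrow> bool" where
  "group_divides_tm G n m \<delta> \<longleftrightarrow>
     (\<exists>H e h. H \<subseteq> trans_monoid n m \<delta> \<and>
        group \<lparr>carrier = H, monoid.mult = tm_mult n, one = e\<rparr> \<and>
        h \<in> hom \<lparr>carrier = H, monoid.mult = tm_mult n, one = e\<rparr> G \<and>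
        h ` H = carrier G)"

definition rho :: "('o, 'm, 'x) dag_cat_scheme \<Rightarrow> nat \<Rightarrow> nat \<Rightarrow> (nat \<Rightarrow> nat \<Rightarrow> nat) \<Rightarrow> 'o \<Rightarrow> nat \<Rightarrow> 'm" where
  "rho C n m \<delta> A i = tup C (pw C A n) (map (\<lambda>j. proj C A n (\<delta> i j)) [0..<m])"

definition fQ :: "('o, 'm, 'x) dag_cat_scheme \<Rightarrow> nat \<Rightarrow> nat \<Rightarrow> (nat \<Rightarrow> nat \<Rightarrow> nat) \<Rightarrow> 'o \<Rightarrow> 'o \<Rightarrow> 'm \<Rightarrow> 'm" where
  "fQ C n m \<delta> A D f =
     tup C (prd C (pw C A n) D) (map (\<lambda>i. cmp C f (cross C (rho C n m \<delta> A i) (ident C D))) [0..<n])"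

definition Gamma_init :: "('o, 'm, 'x) dag_cat_scheme \<Rightarrow> nat \<Rightarrow> nat \<Rightarrow> (nat \<Rightarrow> nat \<Rightarrow> nat) \<Rightarrow> nat \<Rightarrow> bool" where
  "Gamma_init C n m \<delta> i \<longleftrightarrow>
     (\<forall>A \<in> ob C. \<forall>D \<in> ob C. \<forall>f. homc C f (prd C (pw C A m) D) A \<longrightarrow>
        cmp C (proj C A n i) (dag C (pw C A n) D (fQ C n m \<delta> A D f)) =
        dag C A D (cmp C f (cross C (diag C A m) (ident C D))))"

definition Gamma_aut :: "('o, 'm, 'x) dag_cat_scheme \<Rightarrow> nat \<Rightarrow> nat \<Rightarrow> (nat \<Rightarrow> nat \<Rightarrow> nat) \<Rightarrow> bool" where
  "Gamma_aut C n m \<delta> \<longleftrightarrow>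
     (\<forall>A \<in> ob C. \<forall>D \<in> ob C. \<forall>f. homc C f (prd C (pw C A m) D) A \<longrightarrow>
        dag C (pw C A n) D (fQ C n m \<delta> A D f) =
        cmp C (diag C A n) (dag C A D (cmp C f (cross C (diag C A m) (ident C D)))))"

text \<open>\<open>\<Gamma>(G)\<close>: \<open>\<Gamma>(Q_G)\<close> for \<open>Q_G = (G, G, \<cdot>)\<close>, with states and letters both enumerated
  by an (arbitrary) bijection \<open>e : {0..<|G|} \<rightarrow> G\<close>.\<close>
definition Gamma_group :: "('o, 'm, 'x) dag_cat_scheme \<Rightarrow> ('g, 'b) monoid_scheme \<Rightarrow> bool" where
  "Gamma_group C G \<longleftrightarrow>
     (\<forall>e. bij_betw e {0..<card (carrier G)} (carrier G) \<longrightarrow>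
        Gamma_aut C (card (carrier G)) (card (carrier G))
          (\<lambda>i j. inv_into {0..<card (carrier G)} e (e i \<otimes>\<^bsub>G\<^esub> e j)))"

end

theory Submission
  imports Defs
begin

text \<open>
  A morphism \<open>f : A^k \<times> D \<rightarrow> A\<close> and an automaton with \<open>k\<close> letters define a system of fixed point
  equations, one variable per state. Solutions are preserved by injective automaton morphisms, and
  copy equations \<open>x = y\<close> without cycles can be eliminated. Let \<open>\<Gamma>(Q, q)\<close> hold, let \<open>w_j\<close> be nonempty
  words over the alphabet of \<open>Q\<close>, and let \<open>Q'\<close> be \<open>Q\<close> with the letter \<open>j\<close> acting as \<open>w_j\<close>. Applying
  \<open>\<Gamma>(Q, q)\<close> to an object whose variables are pairs of a state of an arbitrary automaton \<open>R\<close> and a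
  word shows that the solution for \<open>Q' \<times> R\<close> at \<open>(qu, r)\<close> is the solution for \<open>R\<close> at \<open>r\<close>. As every
  state has the form \<open>qu\<close>, iterating gives the same for \<open>Q'^n \<times> R\<close> at every state.

  If \<open>h\<close> maps the group \<open>H \<subseteq> M(Q)\<close> onto \<open>G\<close> and \<open>w_j\<close> represents a preimage of the \<open>j\<close>-th element of
  \<open>G\<close>, then \<open>H\<close> embeds into \<open>Q'^n \<times> G\<close> by \<open>x \<mapsto> (x, h x)\<close> and into \<open>Q'^n \<times> {()}\<close> by \<open>x \<mapsto> (x, ())\<close>.
  Hence the solution for \<open>H\<close> at \<open>x\<close> is both the solution for \<open>Q_G\<close> at \<open>h x\<close> and that of the one-state
  automaton, which is \<open>(f \<circ> (\<Delta> \<times> 1))\<^sup>\<dagger>\<close>.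
\<close>

lemma run_less:
  assumes "automaton n m \<delta>" "i < n" "set x \<subseteq> {0..<m}"
  shows "run \<delta> i x < n"
  using assms unfolding run_def automaton_def by (induction x arbitrary: i) auto

section \<open>Calculus of finite products in the category\<close>

locale conway =
  fixes C :: "('o, 'm, 'x) dag_cat_scheme"
  assumes conway: "conway_category C"
begin

abbreviation comp_syntax (infixr "\<cdot>" 70) where "g \<cdot> f \<equiv> cmp C g f"
abbreviation prod_syntax (infixr "\<boxtimes>" 75) where "X \<boxtimes> Y \<equiv> prd C X Y"
abbreviation hom_syntax ("(_ : _ \<leadsto> _)" [61, 61, 61] 60) where "f : X \<leadsto> Y \<equiv> homc C f X Y"
abbreviation pair_syntax ("\<langle>_, _\<rangle>") where "\<langle>f, g\<rangle> \<equiv> pair C f g"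

lemma cart: "cartesian_category C"
  using conway unfolding conway_category_def by (elim conjE)

lemma category_laws:
  shows "\<forall>f \<in> ar C. src C f \<in> ob C \<and> tgt C f \<in> ob C"
    and "\<forall>X \<in> ob C. ident C X : X \<leadsto> X"
    and "\<forall>f g X Y Z. f : X \<leadsto> Y \<longrightarrow> g : Y \<leadsto> Z \<longrightarrow> g \<cdot> f : X \<leadsto> Z"
    and "\<forall>f X Y. f : X \<leadsto> Y \<longrightarrow> f \<cdot> ident C X = f \<and> ident C Y \<cdot> f = f"
    and "\<forall>f g h X Y Z W. f : X \<leadsto> Y \<longrightarrow> g : Y \<leadsto> Z \<longrightarrow> h : Z \<leadsto> W \<longrightarrow> h \<cdot> g \<cdot> f = (h \<cdot> g) \<cdot> f"
    and "\<forall>X \<in> ob C. bang C X : X \<leadsto> trm C \<and> (\<forall>f. f : X \<leadsto> trm C \<longrightarrow> f = bang C X)"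
  using cart unfolding cartesian_category_def by - (elim conjE, assumption)+

lemma hom_ob: "f : X \<leadsto> Y \<Longrightarrow> X \<in> ob C \<and> Y \<in> ob C"
  using category_laws(1) unfolding homc_def by blast

lemma hom_src: "f : X \<leadsto> Y \<Longrightarrow> src C f = X"
  unfolding homc_def by blast

lemma id_hom: "X \<in> ob C \<Longrightarrow> ident C X : X \<leadsto> X"
  using category_laws(2) by blast

lemma comp_hom: "g : Y \<leadsto> Z \<Longrightarrow> f : X \<leadsto> Y \<Longrightarrow> g \<cdot> f : X \<leadsto> Z"
  using category_laws(3) by blast

lemma comp_id: "f : X \<leadsto> Y \<Longrightarrow> f \<cdot> ident C X = f"
  using category_laws(4) by simp

lemma id_comp: "f : X \<leadsto> Y \<Longrightarrow> ident C Y \<cdot> f = f"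
  using category_laws(4) by simp

lemma assoc: "h : Z \<leadsto> W \<Longrightarrow> g : Y \<leadsto> Z \<Longrightarrow> f : X \<leadsto> Y \<Longrightarrow> (h \<cdot> g) \<cdot> f = h \<cdot> g \<cdot> f"
  by (rule category_laws(5)[rule_format, symmetric])

lemma trm_ob: "trm C \<in> ob C"
  using cart unfolding cartesian_category_def by (elim conjE) assumption

lemma bang_hom: "X \<in> ob C \<Longrightarrow> bang C X : X \<leadsto> trm C"
  using category_laws(6) by blast

lemma bang_unique: "f : X \<leadsto> trm C \<Longrightarrow> f = bang C X"
  using category_laws(6) hom_ob by blast

lemma binary_product:
  assumes "X \<in> ob C" "Y \<in> ob C"
  shows "X \<boxtimes> Y \<in> ob C"
    and "pi1 C X Y : X \<boxtimes> Y \<leadsto> X" and "pi2 C X Y : X \<boxtimes> Y \<leadsto> Y"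
    and "\<And>E f g. f : E \<leadsto> X \<Longrightarrow> g : E \<leadsto> Y \<Longrightarrow>
           \<langle>f, g\<rangle> : E \<leadsto> X \<boxtimes> Y \<and> pi1 C X Y \<cdot> \<langle>f, g\<rangle> = f \<and> pi2 C X Y \<cdot> \<langle>f, g\<rangle> = g"
    and "\<And>E h. h : E \<leadsto> X \<boxtimes> Y \<Longrightarrow> \<langle>pi1 C X Y \<cdot> h, pi2 C X Y \<cdot> h\<rangle> = h"
proof -
  have "\<forall>A \<in> ob C. \<forall>B \<in> ob C.
        prd C A B \<in> ob C \<and>
        homc C (pi1 C A B) (prd C A B) A \<and> homc C (pi2 C A B) (prd C A B) B \<and>
        (\<forall>D f g. homc C f D A \<longrightarrow> homc C g D B \<longrightarrow>
           homc C (pair C f g) D (prd C A B) \<and>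
           cmp C (pi1 C A B) (pair C f g) = f \<and> cmp C (pi2 C A B) (pair C f g) = g) \<and>
        (\<forall>D h. homc C h D (prd C A B) \<longrightarrow>
           pair C (cmp C (pi1 C A B) h) (cmp C (pi2 C A B) h) = h)"
    using cart unfolding cartesian_category_def by (elim conjE) assumption
  note * = this[THEN bspec, OF assms(1), THEN bspec, OF assms(2)]
  show "X \<boxtimes> Y \<in> ob C"
    and "pi1 C X Y : X \<boxtimes> Y \<leadsto> X" and "pi2 C X Y : X \<boxtimes> Y \<leadsto> Y"
    and "\<And>E f g. f : E \<leadsto> X \<Longrightarrow> g : E \<leadsto> Y \<Longrightarrow>
           \<langle>f, g\<rangle> : E \<leadsto> X \<boxtimes> Y \<and> pi1 C X Y \<cdot> \<langle>f, g\<rangle> = f \<and> pi2 C X Y \<cdot> \<langle>f, g\<rangle> = g"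
    and "\<And>E h. h : E \<leadsto> X \<boxtimes> Y \<Longrightarrow> \<langle>pi1 C X Y \<cdot> h, pi2 C X Y \<cdot> h\<rangle> = h"
    using * by blast+
qed

lemmas prod_ob = binary_product(1)
lemmas pi1_hom = binary_product(2)
lemmas pi2_hom = binary_product(3)

lemma pair_hom: "f : E \<leadsto> X \<Longrightarrow> g : E \<leadsto> Y \<Longrightarrow> \<langle>f, g\<rangle> : E \<leadsto> X \<boxtimes> Y"
  using binary_product(4) hom_ob by blast

lemma pi1_pair: "f : E \<leadsto> X \<Longrightarrow> g : E \<leadsto> Y \<Longrightarrow> pi1 C X Y \<cdot> \<langle>f, g\<rangle> = f"
  using binary_product(4) hom_ob by blast

lemma pi2_pair: "f : E \<leadsto> X \<Longrightarrow> g : E \<leadsto> Y \<Longrightarrow> pi2 C X Y \<cdot> \<langle>f, g\<rangle> = g"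
  using binary_product(4) hom_ob by blast

lemma pair_eqI:
  assumes "h : E \<leadsto> X \<boxtimes> Y" "X \<in> ob C" "Y \<in> ob C" "pi1 C X Y \<cdot> h = f" "pi2 C X Y \<cdot> h = g"
  shows "h = \<langle>f, g\<rangle>"
  using binary_product(5)[OF assms(2,3,1)] assms(4,5) by simp

lemma pair_comp:
  assumes f: "f : E \<leadsto> X" and g: "g : E \<leadsto> Y" and h: "h : E' \<leadsto> E"
  shows "\<langle>f, g\<rangle> \<cdot> h = \<langle>f \<cdot> h, g \<cdot> h\<rangle>"
proof -
  have obs: "X \<in> ob C" "Y \<in> ob C" using f g hom_ob by blast+
  have p: "\<langle>f, g\<rangle> : E \<leadsto> X \<boxtimes> Y" by (rule pair_hom[OF f g])
  show ?thesis
  proof (rule pair_eqI[OF comp_hom[OF p h] obs])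
    show "pi1 C X Y \<cdot> \<langle>f, g\<rangle> \<cdot> h = f \<cdot> h"
      using assoc[OF pi1_hom[OF obs] p h] pi1_pair[OF f g] by simp
    show "pi2 C X Y \<cdot> \<langle>f, g\<rangle> \<cdot> h = g \<cdot> h"
      using assoc[OF pi2_hom[OF obs] p h] pi2_pair[OF f g] by simp
  qed
qed

text \<open>The two projections are themselves such a pair of generalized elements, and their
  pairing is the identity. Equations between morphisms out of a product can thus be checked below
  like equations between terms in variables.\<close>

lemma hom_prod_eqI:
  assumes "F : X \<boxtimes> D \<leadsto> Y" "G : X \<boxtimes> D \<leadsto> Y" "X \<in> ob C" "D \<in> ob C"
    and eq: "\<And>E x d. x : E \<leadsto> X \<Longrightarrow> d : E \<leadsto> D \<Longrightarrow> F \<cdot> \<langle>x, d\<rangle> = G \<cdot> \<langle>x, d\<rangle>"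
  shows "F = G"
proof -
  have "ident C (X \<boxtimes> D) = \<langle>pi1 C X D, pi2 C X D\<rangle>"
    by (rule pair_eqI[OF id_hom[OF prod_ob[OF assms(3,4)]] assms(3,4)])
      (rule comp_id[OF pi1_hom[OF assms(3,4)]], rule comp_id[OF pi2_hom[OF assms(3,4)]])
  with eq[OF pi1_hom pi2_hom] comp_id[OF assms(1)] comp_id[OF assms(2)] assms(3,4) show ?thesis
    by simp
qed

lemma prod_assoc:
  assumes "X \<in> ob C" "Y \<in> ob C" "Z \<in> ob C"
  shows "(X \<boxtimes> Y) \<boxtimes> Z = X \<boxtimes> Y \<boxtimes> Z"
    and "pi1 C X (Y \<boxtimes> Z) = pi1 C X Y \<cdot> pi1 C (X \<boxtimes> Y) Z"
    and "pi1 C Y Z \<cdot> pi2 C X (Y \<boxtimes> Z) = pi2 C X Y \<cdot> pi1 C (X \<boxtimes> Y) Z"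
    and "pi2 C Y Z \<cdot> pi2 C X (Y \<boxtimes> Z) = pi2 C (X \<boxtimes> Y) Z"
proof -
  have "\<forall>A \<in> ob C. \<forall>B \<in> ob C. \<forall>D \<in> ob C.
        prd C (prd C A B) D = prd C A (prd C B D) \<and>
        pi1 C A (prd C B D) = cmp C (pi1 C A B) (pi1 C (prd C A B) D) \<and>
        cmp C (pi1 C B D) (pi2 C A (prd C B D)) = cmp C (pi2 C A B) (pi1 C (prd C A B) D) \<and>
        cmp C (pi2 C B D) (pi2 C A (prd C B D)) = pi2 C (prd C A B) D"
    using cart unfolding cartesian_category_def by (elim conjE) assumption
  note * = this[rule_format, OF assms]
  show "(X \<boxtimes> Y) \<boxtimes> Z = X \<boxtimes> Y \<boxtimes> Z"
    and "pi1 C X (Y \<boxtimes> Z) = pi1 C X Y \<cdot> pi1 C (X \<boxtimes> Y) Z"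
    and "pi1 C Y Z \<cdot> pi2 C X (Y \<boxtimes> Z) = pi2 C X Y \<cdot> pi1 C (X \<boxtimes> Y) Z"
    and "pi2 C Y Z \<cdot> pi2 C X (Y \<boxtimes> Z) = pi2 C (X \<boxtimes> Y) Z"
    using * by - (elim conjE, assumption)+
qed

text \<open>Both sides live in the same object because products are strictly associative, and the
  strict laws for the projections identify the components. \<open>dag_double\<close> uses this to
  rewrite the effect of the diagonal as a right-nested pair.\<close>

lemma pair_assoc:
  assumes a: "a : E \<leadsto> X" and b: "b : E \<leadsto> Y" and d: "d : E \<leadsto> Z"
  shows "\<langle>\<langle>a, b\<rangle>, d\<rangle> = \<langle>a, \<langle>b, d\<rangle>\<rangle>"
proof -
  have obs: "X \<in> ob C" "Y \<in> ob C" "Z \<in> ob C" using a b d hom_ob by blast+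
  note as = prod_assoc[OF obs]
  have XY: "X \<boxtimes> Y \<in> ob C" and YZ: "Y \<boxtimes> Z \<in> ob C" by (simp_all add: obs prod_ob)
  have ab: "\<langle>a, b\<rangle> : E \<leadsto> X \<boxtimes> Y" by (rule pair_hom[OF a b])
  have h: "\<langle>\<langle>a, b\<rangle>, d\<rangle> : E \<leadsto> (X \<boxtimes> Y) \<boxtimes> Z" by (rule pair_hom[OF ab d])
  have h': "\<langle>\<langle>a, b\<rangle>, d\<rangle> : E \<leadsto> X \<boxtimes> Y \<boxtimes> Z" using h as(1) by simp
  note p1 = pi1_hom[OF XY obs(3)] and p2 = pi2_hom[OF obs(1) YZ]
  show ?thesis
  proof (rule pair_eqI[OF h' obs(1) YZ])
    show "pi1 C X (Y \<boxtimes> Z) \<cdot> \<langle>\<langle>a, b\<rangle>, d\<rangle> = a"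
      using assoc[OF pi1_hom[OF obs(1,2)] p1 h] pi1_pair[OF ab d] pi1_pair[OF a b] as(2) by simp
    show "pi2 C X (Y \<boxtimes> Z) \<cdot> \<langle>\<langle>a, b\<rangle>, d\<rangle> = \<langle>b, d\<rangle>"
    proof (rule pair_eqI[OF comp_hom[OF p2 h'] obs(2,3)])
      show "pi1 C Y Z \<cdot> pi2 C X (Y \<boxtimes> Z) \<cdot> \<langle>\<langle>a, b\<rangle>, d\<rangle> = b"
        using assoc[OF pi1_hom[OF obs(2,3)] p2 h'] assoc[OF pi2_hom[OF obs(1,2)] p1 h]
          pi1_pair[OF ab d] pi2_pair[OF a b] as(3) by simp
      show "pi2 C Y Z \<cdot> pi2 C X (Y \<boxtimes> Z) \<cdot> \<langle>\<langle>a, b\<rangle>, d\<rangle> = d"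
        using assoc[OF pi2_hom[OF obs(2,3)] p2 h'] pi2_pair[OF ab d] as(4) by simp
    qed
  qed
qed

lemma cross_hom:
  assumes g: "g : X \<leadsto> X'" and h: "h : Y \<leadsto> Y'"
  shows "cross C g h : X \<boxtimes> Y \<leadsto> X' \<boxtimes> Y'"
proof -
  have "X \<in> ob C" "Y \<in> ob C" using g h hom_ob by blast+
  then show ?thesis
    unfolding cross_def hom_src[OF g] hom_src[OF h]
    by (intro pair_hom comp_hom[OF g] comp_hom[OF h] pi1_hom pi2_hom)
qed

lemma cross_pair:
  assumes g: "g : X \<leadsto> X'" and h: "h : Y \<leadsto> Y'" and x: "x : E \<leadsto> X" and y: "y : E \<leadsto> Y"
  shows "cross C g h \<cdot> \<langle>x, y\<rangle> = \<langle>g \<cdot> x, h \<cdot> y\<rangle>"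
proof -
  have obs: "X \<in> ob C" "Y \<in> ob C" using g h hom_ob by blast+
  note p1 = pi1_hom[OF obs] and p2 = pi2_hom[OF obs] and xy = pair_hom[OF x y]
  have "cross C g h \<cdot> \<langle>x, y\<rangle> = \<langle>(g \<cdot> pi1 C X Y) \<cdot> \<langle>x, y\<rangle>, (h \<cdot> pi2 C X Y) \<cdot> \<langle>x, y\<rangle>\<rangle>"
    unfolding cross_def hom_src[OF g] hom_src[OF h]
    by (rule pair_comp[OF comp_hom[OF g p1] comp_hom[OF h p2] xy])
  then show ?thesis
    using assoc[OF g p1 xy] assoc[OF h p2 xy] pi1_pair[OF x y] pi2_pair[OF x y] by simp
qed

section \<open>The dagger laws in terms of generalized elements\<close>

lemma conway_laws:
  shows "\<forall>X \<in> ob C. \<forall>D \<in> ob C. \<forall>f. f : X \<boxtimes> D \<leadsto> X \<longrightarrow> dag C X D f : D \<leadsto> X"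
    and "\<forall>X \<in> ob C. \<forall>B \<in> ob C. \<forall>D \<in> ob C. \<forall>f g. f : X \<boxtimes> B \<leadsto> X \<longrightarrow> g : D \<leadsto> B \<longrightarrow>
      dag C X D (f \<cdot> cross C (ident C X) g) = dag C X B f \<cdot> g"
    and "\<forall>X \<in> ob C. \<forall>D \<in> ob C. \<forall>f. f : X \<boxtimes> X \<boxtimes> D \<leadsto> X \<longrightarrow>
      dag C X D (dag C X (X \<boxtimes> D) f) = dag C X D (f \<cdot> cross C (diag C X 2) (ident C D))"
    and "\<forall>X \<in> ob C. \<forall>Y \<in> ob C. \<forall>D \<in> ob C. \<forall>f g. f : Y \<boxtimes> D \<leadsto> X \<longrightarrow> g : X \<boxtimes> D \<leadsto> Y \<longrightarrow>
      dag C X D (f \<cdot> \<langle>g, pi2 C X D\<rangle>) =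
      f \<cdot> \<langle>dag C Y D (g \<cdot> \<langle>f, pi2 C Y D\<rangle>), ident C D\<rangle>"
  using conway unfolding conway_category_def by - (elim conjE, assumption)+

lemma dag_hom: "F : X \<boxtimes> D \<leadsto> X \<Longrightarrow> X \<in> ob C \<Longrightarrow> D \<in> ob C \<Longrightarrow> dag C X D F : D \<leadsto> X"
  using conway_laws(1) by blast

text \<open>The parameter identity with \<open>cross\<close> replaced by an equation on generalized
  elements, so that \<open>G\<close> need not be presented as a composite. \<open>dag_double\<close>
  and \<open>dag_composition\<close> recast the other two laws in the same way.\<close>

lemma dag_parameter:
  assumes F: "F : X \<boxtimes> B \<leadsto> X" and g: "g : D \<leadsto> B" and G: "G : X \<boxtimes> D \<leadsto> X" and X: "X \<in> ob C"
    and eq: "\<And>E x d. x : E \<leadsto> X \<Longrightarrow> d : E \<leadsto> D \<Longrightarrow> G \<cdot> \<langle>x, d\<rangle> = F \<cdot> \<langle>x, g \<cdot> d\<rangle>"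
  shows "dag C X D G = dag C X B F \<cdot> g"
proof -
  have obs: "D \<in> ob C" "B \<in> ob C" using g hom_ob by blast+
  note c = cross_hom[OF id_hom[OF X] g]
  have "G = F \<cdot> cross C (ident C X) g"
  proof (rule hom_prod_eqI[OF G comp_hom[OF F c] X obs(1)])
    fix E x d assume x: "x : E \<leadsto> X" and d: "d : E \<leadsto> D"
    show "G \<cdot> \<langle>x, d\<rangle> = (F \<cdot> cross C (ident C X) g) \<cdot> \<langle>x, d\<rangle>"
      using assoc[OF F c pair_hom[OF x d]] cross_pair[OF id_hom[OF X] g x d] id_comp[OF x] eq[OF x d]
      by simp
  qed
  then show ?thesis using conway_laws(2)[rule_format, OF X obs(2,1) F g] by simp
qed

lemma dag_double:
  assumes H: "H : X \<boxtimes> X \<boxtimes> D \<leadsto> X" and F: "F : X \<boxtimes> D \<leadsto> X" and X: "X \<in> ob C" and D: "D \<in> ob C"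
    and eq: "\<And>E x d. x : E \<leadsto> X \<Longrightarrow> d : E \<leadsto> D \<Longrightarrow> F \<cdot> \<langle>x, d\<rangle> = H \<cdot> \<langle>x, \<langle>x, d\<rangle>\<rangle>"
  shows "dag C X D F = dag C X D (dag C X (X \<boxtimes> D) H)"
proof -
  have diag: "diag C X 2 = \<langle>ident C X, ident C X\<rangle>"
    by (simp add: diag_def numeral_2_eq_2)
  have dh: "diag C X 2 : X \<leadsto> X \<boxtimes> X" unfolding diag by (intro pair_hom id_hom X)
  have c: "cross C (diag C X 2) (ident C D) : X \<boxtimes> D \<leadsto> X \<boxtimes> X \<boxtimes> D"
    using cross_hom[OF dh id_hom[OF D]] prod_assoc(1)[OF X X D] by simp
  have "F = H \<cdot> cross C (diag C X 2) (ident C D)"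
  proof (rule hom_prod_eqI[OF F comp_hom[OF H c] X D])
    fix E x d assume x: "x : E \<leadsto> X" and d: "d : E \<leadsto> D"
    have "diag C X 2 \<cdot> x = \<langle>x, x\<rangle>"
      unfolding diag using pair_comp[OF id_hom[OF X] id_hom[OF X] x] id_comp[OF x] by simp
    then show "F \<cdot> \<langle>x, d\<rangle> = (H \<cdot> cross C (diag C X 2) (ident C D)) \<cdot> \<langle>x, d\<rangle>"
      using assoc[OF H c pair_hom[OF x d]] cross_pair[OF dh id_hom[OF D] x d] id_comp[OF d] eq[OF x d]
        pair_assoc[OF x x d]
      by simp
  qed
  then show ?thesis using conway_laws(3)[rule_format, OF X D H] by simp
qed

lemma dag_composition:
  assumes f: "f : Y \<boxtimes> D \<leadsto> X" and g: "g : X \<boxtimes> D \<leadsto> Y"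
    and P: "P : X \<boxtimes> D \<leadsto> X" and Q: "Q : Y \<boxtimes> D \<leadsto> Y"
    and X: "X \<in> ob C" and Y: "Y \<in> ob C" and D: "D \<in> ob C"
    and eqP: "\<And>E x d. x : E \<leadsto> X \<Longrightarrow> d : E \<leadsto> D \<Longrightarrow> P \<cdot> \<langle>x, d\<rangle> = f \<cdot> \<langle>g \<cdot> \<langle>x, d\<rangle>, d\<rangle>"
    and eqQ: "\<And>E y d. y : E \<leadsto> Y \<Longrightarrow> d : E \<leadsto> D \<Longrightarrow> Q \<cdot> \<langle>y, d\<rangle> = g \<cdot> \<langle>f \<cdot> \<langle>y, d\<rangle>, d\<rangle>"
  shows "dag C X D P = f \<cdot> \<langle>dag C Y D Q, ident C D\<rangle>"
proof -
  have *: "S = u \<cdot> \<langle>v, pi2 C V D\<rangle>"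
    if u: "u : W \<boxtimes> D \<leadsto> V" and v: "v : V \<boxtimes> D \<leadsto> W" and S: "S : V \<boxtimes> D \<leadsto> V" and V: "V \<in> ob C"
      and eqS: "\<And>E x d. x : E \<leadsto> V \<Longrightarrow> d : E \<leadsto> D \<Longrightarrow> S \<cdot> \<langle>x, d\<rangle> = u \<cdot> \<langle>v \<cdot> \<langle>x, d\<rangle>, d\<rangle>"
    for u v S V W
  proof (rule hom_prod_eqI[OF S _ V D])
    note p = pi2_hom[OF V D]
    note vp = pair_hom[OF v p]
    show "u \<cdot> \<langle>v, pi2 C V D\<rangle> : V \<boxtimes> D \<leadsto> V" by (rule comp_hom[OF u vp])
    fix E x d assume x: "x : E \<leadsto> V" and d: "d : E \<leadsto> D"
    show "S \<cdot> \<langle>x, d\<rangle> = (u \<cdot> \<langle>v, pi2 C V D\<rangle>) \<cdot> \<langle>x, d\<rangle>"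
      using assoc[OF u vp pair_hom[OF x d]] pair_comp[OF v p pair_hom[OF x d]] pi2_pair[OF x d]
        eqS[OF x d] by simp
  qed
  show ?thesis
    using conway_laws(4)[rule_format, OF X Y D f g] *[OF f g P X eqP] *[OF g f Q Y eqQ] by simp
qed

text \<open>The composition identity for \<open>F\<close> and the first projection: both composites
  are \<open>F\<close> again.\<close>

lemma dag_fixpoint:
  assumes F: "F : X \<boxtimes> D \<leadsto> X" and X: "X \<in> ob C" and D: "D \<in> ob C"
  shows "dag C X D F = F \<cdot> \<langle>dag C X D F, ident C D\<rangle>"
proof (rule dag_composition[OF F pi1_hom[OF X D] F F X X D])
  fix E x d assume x: "x : E \<leadsto> X" and d: "d : E \<leadsto> D"
  show "F \<cdot> \<langle>x, d\<rangle> = F \<cdot> \<langle>pi1 C X D \<cdot> \<langle>x, d\<rangle>, d\<rangle>" using pi1_pair[OF x d] by simp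
  show "F \<cdot> \<langle>x, d\<rangle> = pi1 C X D \<cdot> \<langle>F \<cdot> \<langle>x, d\<rangle>, d\<rangle>"
    using pi1_pair[OF comp_hom[OF F pair_hom[OF x d]] d] by simp
qed

section \<open>Powers of an object over arbitrary index sets\<close>

text \<open>The universal property of a product of \<open>I\<close> copies of \<open>A\<close> with
  projections \<open>v\<close>, for whatever object carries it. Unknowns can then be indexed
  directly by states, pairs or words, without fixing an enumeration.\<close>

definition is_power :: "'o \<Rightarrow> 'o \<Rightarrow> 'i set \<Rightarrow> ('i \<Rightarrow> 'm) \<Rightarrow> bool" where
  "is_power A X I v \<longleftrightarrow> X \<in> ob C \<and> (\<forall>i\<in>I. v i : X \<leadsto> A) \<and>
     (\<forall>E g. E \<in> ob C \<longrightarrow> (\<forall>i\<in>I. g i : E \<leadsto> A) \<longrightarrow> (\<exists>h. h : E \<leadsto> X \<and> (\<forall>i\<in>I. v i \<cdot> h = g i))) \<and>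
     (\<forall>E h h'. h : E \<leadsto> X \<longrightarrow> h' : E \<leadsto> X \<longrightarrow> (\<forall>i\<in>I. v i \<cdot> h = v i \<cdot> h') \<longrightarrow> h = h')"

lemma is_powerI:
  assumes "X \<in> ob C" "\<And>i. i \<in> I \<Longrightarrow> v i : X \<leadsto> A"
    and "\<And>E g. E \<in> ob C \<Longrightarrow> (\<And>i. i \<in> I \<Longrightarrow> g i : E \<leadsto> A) \<Longrightarrow> \<exists>h. h : E \<leadsto> X \<and> (\<forall>i\<in>I. v i \<cdot> h = g i)"
    and "\<And>E h h'. h : E \<leadsto> X \<Longrightarrow> h' : E \<leadsto> X \<Longrightarrow> (\<And>i. i \<in> I \<Longrightarrow> v i \<cdot> h = v i \<cdot> h') \<Longrightarrow> h = h'"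
  shows "is_power A X I v"
  unfolding is_power_def
proof (intro conjI ballI allI impI)
  fix E g assume E: "E \<in> ob C" and g: "\<forall>i\<in>I. g i : E \<leadsto> A"
  show "\<exists>h. h : E \<leadsto> X \<and> (\<forall>i\<in>I. v i \<cdot> h = g i)"
    by (rule assms(3)[OF E]) (rule bspec[OF g])
next
  fix E h h' assume h: "h : E \<leadsto> X" "h' : E \<leadsto> X" and "\<forall>i\<in>I. v i \<cdot> h = v i \<cdot> h'"
  then show "h = h'" by (intro assms(4)[OF h]) (rule bspec)
qed (fact assms(1), erule assms(2))

lemma power_ob: "is_power A X I v \<Longrightarrow> X \<in> ob C"
  unfolding is_power_def by (elim conjE)

lemma power_hom: "is_power A X I v \<Longrightarrow> i \<in> I \<Longrightarrow> v i : X \<leadsto> A"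
  unfolding is_power_def by (elim conjE) (rule bspec)

lemma power_tuple:
  assumes p: "is_power A X I v" and E: "E \<in> ob C" and g: "\<And>i. i \<in> I \<Longrightarrow> g i : E \<leadsto> A"
  obtains h where "h : E \<leadsto> X" "\<And>i. i \<in> I \<Longrightarrow> v i \<cdot> h = g i"
proof -
  have "\<forall>E g. E \<in> ob C \<longrightarrow> (\<forall>i\<in>I. g i : E \<leadsto> A) \<longrightarrow> (\<exists>h. h : E \<leadsto> X \<and> (\<forall>i\<in>I. v i \<cdot> h = g i))"
    using p unfolding is_power_def by (elim conjE)
  from this[rule_format, OF E g] obtain h where "h : E \<leadsto> X \<and> (\<forall>i\<in>I. v i \<cdot> h = g i)" ..
  then show thesis by (intro that[of h]) simp_all
qed

lemma power_eqI:
  assumes p: "is_power A X I v" and h: "h : E \<leadsto> X" "h' : E \<leadsto> X"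
    and eq: "\<And>i. i \<in> I \<Longrightarrow> v i \<cdot> h = v i \<cdot> h'"
  shows "h = h'"
proof -
  have "\<forall>E h h'. h : E \<leadsto> X \<longrightarrow> h' : E \<leadsto> X \<longrightarrow> (\<forall>i\<in>I. v i \<cdot> h = v i \<cdot> h') \<longrightarrow> h = h'"
    using p unfolding is_power_def by (elim conjE)
  from this[rule_format, OF h eq] show ?thesis .
qed

lemma power_singleton: "A \<in> ob C \<Longrightarrow> is_power A A {i} (\<lambda>_. ident C A)"
  by (rule is_powerI) (auto simp: id_hom id_comp)

lemma power_reindex:
  assumes p: "is_power A X J v" and e: "bij_betw e I J"
  shows "is_power A X I (\<lambda>i. v (e i))"
proof (rule is_powerI)
  show "X \<in> ob C" by (rule power_ob[OF p])
  show "v (e i) : X \<leadsto> A" if "i \<in> I" for i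
    using power_hom[OF p] e that by (auto simp: bij_betw_def)
  show "\<exists>h. h : E \<leadsto> X \<and> (\<forall>i\<in>I. v (e i) \<cdot> h = g i)"
    if E: "E \<in> ob C" and g: "\<And>i. i \<in> I \<Longrightarrow> g i : E \<leadsto> A" for E g
  proof -
    have "g (inv_into I e j) : E \<leadsto> A" if "j \<in> J" for j
      using g e that by (auto simp: bij_betw_def inv_into_into)
    then obtain h where "h : E \<leadsto> X" "\<And>j. j \<in> J \<Longrightarrow> v j \<cdot> h = g (inv_into I e j)"
      using power_tuple[OF p E, of "\<lambda>j. g (inv_into I e j)"] by metis
    then show ?thesis using e by (auto simp: bij_betw_def)
  qed
  show "h = h'" if "h : E \<leadsto> X" "h' : E \<leadsto> X" "\<And>i. i \<in> I \<Longrightarrow> v (e i) \<cdot> h = v (e i) \<cdot> h'" for E h h'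
    by (rule power_eqI[OF p that(1,2)]) (use that(3) e in \<open>auto simp: bij_betw_def\<close>)
qed

text \<open>Used with \<open>B\<close> itself a power of \<open>A\<close>: the identity of the
  automaton at the object \<open>B\<close> then speaks of a system over \<open>A\<close>, with one
  unknown for each pair of a state and an index of \<open>B\<close>.\<close>

lemma power_power:
  assumes p: "is_power A B K v" and r: "is_power B X I u"
  shows "is_power A X (I \<times> K) (\<lambda>(i, k). v k \<cdot> u i)"
proof (rule is_powerI)
  show "X \<in> ob C" by (rule power_ob[OF r])
  show "(case ik of (i, k) \<Rightarrow> v k \<cdot> u i) : X \<leadsto> A" if "ik \<in> I \<times> K" for ik
    using that comp_hom[OF power_hom[OF p] power_hom[OF r]] by auto
  show "\<exists>h. h : E \<leadsto> X \<and> (\<forall>ik\<in>I \<times> K. (case ik of (i, k) \<Rightarrow> v k \<cdot> u i) \<cdot> h = g ik)"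
    if E: "E \<in> ob C" and g: "\<And>ik. ik \<in> I \<times> K \<Longrightarrow> g ik : E \<leadsto> A" for E g
  proof -
    have "\<exists>h. h : E \<leadsto> B \<and> (\<forall>k\<in>K. v k \<cdot> h = g (i, k))" if "i \<in> I" for i
      using power_tuple[OF p E, of "\<lambda>k. g (i, k)"] g that by (metis mem_Sigma_iff)
    then obtain b where b: "\<And>i. i \<in> I \<Longrightarrow> b i : E \<leadsto> B" "\<And>i k. i \<in> I \<Longrightarrow> k \<in> K \<Longrightarrow> v k \<cdot> b i = g (i, k)"
      by metis
    obtain h where h: "h : E \<leadsto> X" "\<And>i. i \<in> I \<Longrightarrow> u i \<cdot> h = b i"
      using power_tuple[OF r E, of b] b(1) by metis
    have "(v k \<cdot> u i) \<cdot> h = g (i, k)" if "i \<in> I" "k \<in> K" for i k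
      using assoc[OF power_hom[OF p that(2)] power_hom[OF r that(1)] h(1)] b(2)[OF that] h(2)[OF that(1)]
      by simp
    then show ?thesis using h(1) by auto
  qed
  show "h = h'" if h: "h : E \<leadsto> X" "h' : E \<leadsto> X"
    and eq: "\<And>ik. ik \<in> I \<times> K \<Longrightarrow> (case ik of (i, k) \<Rightarrow> v k \<cdot> u i) \<cdot> h = (case ik of (i, k) \<Rightarrow> v k \<cdot> u i) \<cdot> h'"
    for E h h'
  proof (rule power_eqI[OF r h])
    fix i assume i: "i \<in> I"
    note u = power_hom[OF r i]
    show "u i \<cdot> h = u i \<cdot> h'"
    proof (rule power_eqI[OF p comp_hom[OF u h(1)] comp_hom[OF u h(2)]])
      fix k assume k: "k \<in> K"
      show "v k \<cdot> u i \<cdot> h = v k \<cdot> u i \<cdot> h'"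
        using eq[of "(i, k)"] i k assoc[OF power_hom[OF p k] u h(1)] assoc[OF power_hom[OF p k] u h(2)]
        by simp
    qed
  qed
qed

lemma power_insert:
  assumes A: "A \<in> ob C" and p: "is_power A X {0..<n} v"
  shows "is_power A (A \<boxtimes> X) {0..<Suc n} (\<lambda>i. if i = 0 then pi1 C A X else v (i - 1) \<cdot> pi2 C A X)"
    (is "is_power A _ _ ?w")
proof (rule is_powerI)
  note X = power_ob[OF p]
  note p1 = pi1_hom[OF A X] and p2 = pi2_hom[OF A X]
  show "A \<boxtimes> X \<in> ob C" by (rule prod_ob[OF A X])
  show "?w i : A \<boxtimes> X \<leadsto> A" if "i \<in> {0..<Suc n}" for i
    using p1 comp_hom[OF power_hom[OF p] p2] that by auto
  show "\<exists>h. h : E \<leadsto> A \<boxtimes> X \<and> (\<forall>i\<in>{0..<Suc n}. ?w i \<cdot> h = g i)"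
    if E: "E \<in> ob C" and g: "\<And>i. i \<in> {0..<Suc n} \<Longrightarrow> g i : E \<leadsto> A" for E g
  proof -
    have g0: "g 0 : E \<leadsto> A" and "\<And>i. i \<in> {0..<n} \<Longrightarrow> g (Suc i) : E \<leadsto> A" using g by auto
    then obtain h where h: "h : E \<leadsto> X" "\<And>i. i \<in> {0..<n} \<Longrightarrow> v i \<cdot> h = g (Suc i)"
      using power_tuple[OF p E, of "\<lambda>i. g (Suc i)"] by blast
    have "?w i \<cdot> \<langle>g 0, h\<rangle> = g i" if i: "i \<in> {0..<Suc n}" for i
    proof (cases i)
      case 0 then show ?thesis using pi1_pair[OF g0 h(1)] by simp
    next
      case (Suc k)
      then have k: "k \<in> {0..<n}" using i by simp
      show ?thesis
        using Suc assoc[OF power_hom[OF p k] p2 pair_hom[OF g0 h(1)]] pi2_pair[OF g0 h(1)] h(2)[OF k] by simp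
    qed
    then show ?thesis using pair_hom[OF g0 h(1)] by blast
  qed
  show "h = h'" if h: "h : E \<leadsto> A \<boxtimes> X" "h' : E \<leadsto> A \<boxtimes> X"
    and eq: "\<And>i. i \<in> {0..<Suc n} \<Longrightarrow> ?w i \<cdot> h = ?w i \<cdot> h'" for E h h'
  proof -
    have 1: "pi1 C A X \<cdot> h = pi1 C A X \<cdot> h'" using eq[of 0] by simp
    have 2: "pi2 C A X \<cdot> h = pi2 C A X \<cdot> h'"
    proof (rule power_eqI[OF p comp_hom[OF p2 h(1)] comp_hom[OF p2 h(2)]])
      fix i assume i: "i \<in> {0..<n}"
      show "v i \<cdot> pi2 C A X \<cdot> h = v i \<cdot> pi2 C A X \<cdot> h'"
        using eq[of "Suc i"] i assoc[OF power_hom[OF p i] p2 h(1)] assoc[OF power_hom[OF p i] p2 h(2)]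
        by simp
    qed
    show "h = h'" using pair_eqI[OF h(1) A X 1 2] pair_eqI[OF h(2) A X refl refl] by simp
  qed
qed

section \<open>The chosen powers and the morphisms built from an automaton\<close>

lemma power_pw:
  assumes A: "A \<in> ob C"
  shows "is_power A (pw C A n) {0..<n} (proj C A n)"
proof (induction n)
  case 0
  show ?case
  proof (rule is_powerI)
    show "h = h'" if "h : E \<leadsto> pw C A 0" "h' : E \<leadsto> pw C A 0" for E h h'
      using that[simplified, THEN bang_unique] by simp
  qed (use trm_ob bang_hom in auto)
next
  case (Suc n)
  show ?case
  proof (cases n)
    \<comment> \<open>The first power is \<open>A\<close> itself rather than \<open>A\<close> times
      the terminal object, so this case is not an instance of \<open>power_insert\<close>.\<close>
    case 0
    then show ?thesis
      using power_reindex[OF power_singleton[OF A, of "0::nat"], of id "{0..<1}"] by simp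
  next
    case (Suc l)
    have "proj C A (Suc n) = (\<lambda>i. if i = 0 then pi1 C A (pw C A n)
        else proj C A n (i - 1) \<cdot> pi2 C A (pw C A n))"
      unfolding Suc by (rule ext) simp
    moreover have "pw C A (Suc n) = A \<boxtimes> pw C A n" unfolding Suc by simp
    ultimately show ?thesis using power_insert[OF A Suc.IH] by simp
  qed
qed

lemma pw_ob: "A \<in> ob C \<Longrightarrow> pw C A n \<in> ob C"
  by (rule power_ob[OF power_pw])

lemma proj_hom: "A \<in> ob C \<Longrightarrow> i < n \<Longrightarrow> proj C A n i : pw C A n \<leadsto> A"
  using power_hom[OF power_pw] by simp

lemma tup_list:
  assumes A: "A \<in> ob C" and E: "E \<in> ob C" and "\<forall>g\<in>set gs. g : E \<leadsto> A"
  shows "tup C E gs : E \<leadsto> pw C A (length gs) \<and>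
    (\<forall>i<length gs. proj C A (length gs) i \<cdot> tup C E gs = gs ! i)"
  using assms(3)
proof (induction gs rule: induct_list012)
  case 1
  show ?case using bang_hom[OF E] by simp
next
  case (2 g)
  then show ?case using id_comp by simp
next
  case (3 g g' gs)
  let ?t = "tup C E (g' # gs)" and ?l = "Suc (length gs)"
  have g: "g : E \<leadsto> A" and t: "?t : E \<leadsto> pw C A ?l"
    and nth: "\<And>i. i < ?l \<Longrightarrow> proj C A ?l i \<cdot> ?t = (g' # gs) ! i"
    using 3 by auto
  note p2 = pi2_hom[OF A pw_ob[OF A, of ?l]]
  have "proj C A (Suc ?l) i \<cdot> \<langle>g, ?t\<rangle> = (g # g' # gs) ! i" if i: "i < Suc ?l" for i
  proof (cases i)
    case 0
    then show ?thesis using pi1_pair[OF g t] by simp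
  next
    case (Suc k)
    then have k: "k < ?l" using i by simp
    show ?thesis
      using Suc assoc[OF proj_hom[OF A k] p2 pair_hom[OF g t]] pi2_pair[OF g t] nth[OF k] by simp
  qed
  then show ?case using pair_hom[OF g t] by simp
qed

lemma tup_hom:
  "A \<in> ob C \<Longrightarrow> E \<in> ob C \<Longrightarrow> (\<And>j. j < k \<Longrightarrow> g j : E \<leadsto> A) \<Longrightarrow> tup C E (map g [0..<k]) : E \<leadsto> pw C A k"
  using tup_list[of A E "map g [0..<k]"] by auto

lemma proj_tup:
  "A \<in> ob C \<Longrightarrow> E \<in> ob C \<Longrightarrow> (\<And>j. j < k \<Longrightarrow> g j : E \<leadsto> A) \<Longrightarrow> i < k \<Longrightarrow>
     proj C A k i \<cdot> tup C E (map g [0..<k]) = g i"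
  using tup_list[of A E "map g [0..<k]"] by auto

lemma tup_comp:
  assumes A: "A \<in> ob C" and g: "\<And>j. j < k \<Longrightarrow> g j : E \<leadsto> A" and x: "x : E' \<leadsto> E"
  shows "tup C E (map g [0..<k]) \<cdot> x = tup C E' (map (\<lambda>j. g j \<cdot> x) [0..<k])"
proof -
  have E: "E \<in> ob C" "E' \<in> ob C" using x hom_ob by blast+
  have gx: "g j \<cdot> x : E' \<leadsto> A" if "j < k" for j using comp_hom[OF g[OF that] x] .
  note t = tup_hom[OF A E(1) g]
  show ?thesis
  proof (rule power_eqI[OF power_pw[OF A] comp_hom[OF t x] tup_hom[OF A E(2) gx]])
    fix i assume "i \<in> {0..<k}"
    then have i: "i < k" by simp
    show "proj C A k i \<cdot> tup C E (map g [0..<k]) \<cdot> x = proj C A k i \<cdot> tup C E' (map (\<lambda>j. g j \<cdot> x) [0..<k])"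
      using assoc[OF proj_hom[OF A i] t x] proj_tup[OF A E(1) g i] proj_tup[OF A E(2) gx i] by simp
  qed
qed

lemma diag_comp:
  assumes A: "A \<in> ob C" and x: "x : E \<leadsto> A"
  shows "diag C A k \<cdot> x = tup C E (map (\<lambda>_. x) [0..<k])"
proof -
  have "diag C A k = tup C A (map (\<lambda>_. ident C A) [0..<k])"
    by (simp add: diag_def map_replicate_const)
  then show ?thesis using tup_comp[OF A id_hom[OF A] x] id_comp[OF x] by simp
qed

lemma diag_hom: "A \<in> ob C \<Longrightarrow> diag C A k : A \<leadsto> pw C A k"
  using tup_hom[of A A k "\<lambda>_. ident C A"] id_hom by (simp add: diag_def map_replicate_const)

lemma finite_power_ex:
  assumes "A \<in> ob C" "finite I"
  obtains X v where "is_power A X I v"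
proof -
  obtain e where "bij_betw e I {0..<card I}" using ex_bij_betw_finite_nat[OF assms(2)] by blast
  then show thesis using power_reindex[OF power_pw[OF assms(1)]] that by blast
qed

text \<open>Component \<open>i\<close> of \<open>fQ\<close> is the right-hand side of the equation
  of state \<open>i\<close>, whose argument \<open>j\<close> is the unknown at the successor
  \<open>\<delta> i j\<close>. This description replaces the definition of \<open>fQ\<close> from
  here on.\<close>

lemma fQ_hom:
  assumes A: "A \<in> ob C" and D: "D \<in> ob C" and f: "f : pw C A m \<boxtimes> D \<leadsto> A"
    and \<delta>: "\<forall>i<n. \<forall>j<m. \<delta> i j < n"
  shows "fQ C n m \<delta> A D f : pw C A n \<boxtimes> D \<leadsto> pw C A n"
    and "\<And>E x d i. x : E \<leadsto> pw C A n \<Longrightarrow> d : E \<leadsto> D \<Longrightarrow> i < n \<Longrightarrow>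
      proj C A n i \<cdot> fQ C n m \<delta> A D f \<cdot> \<langle>x, d\<rangle> =
      f \<cdot> \<langle>tup C E (map (\<lambda>j. proj C A n (\<delta> i j) \<cdot> x) [0..<m]), d\<rangle>"
proof -
  have p: "proj C A n (\<delta> i j) : pw C A n \<leadsto> A" if "i < n" "j < m" for i j
    using proj_hom[OF A] \<delta> that by simp
  have rho: "rho C n m \<delta> A i : pw C A n \<leadsto> pw C A m" if "i < n" for i
    unfolding rho_def by (rule tup_hom[OF A pw_ob[OF A] p[OF that]])
  have c: "cross C (rho C n m \<delta> A i) (ident C D) : pw C A n \<boxtimes> D \<leadsto> pw C A m \<boxtimes> D" if "i < n" for i
    by (rule cross_hom[OF rho[OF that] id_hom[OF D]])
  note fc = comp_hom[OF f c]
  note P = prod_ob[OF pw_ob[OF A] D]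
  show fQ: "fQ C n m \<delta> A D f : pw C A n \<boxtimes> D \<leadsto> pw C A n"
    unfolding fQ_def by (rule tup_hom[OF A P fc])
  fix E x d i assume x: "x : E \<leadsto> pw C A n" and d: "d : E \<leadsto> D" and i: "i < n"
  have "proj C A n i \<cdot> fQ C n m \<delta> A D f \<cdot> \<langle>x, d\<rangle> =
      (f \<cdot> cross C (rho C n m \<delta> A i) (ident C D)) \<cdot> \<langle>x, d\<rangle>"
    using assoc[OF proj_hom[OF A i] fQ pair_hom[OF x d]] proj_tup[OF A P fc i]
    unfolding fQ_def by simp
  also have "\<dots> = f \<cdot> \<langle>rho C n m \<delta> A i \<cdot> x, d\<rangle>"
    using assoc[OF f c[OF i] pair_hom[OF x d]] cross_pair[OF rho[OF i] id_hom[OF D] x d] id_comp[OF d]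
    by simp
  also have "rho C n m \<delta> A i \<cdot> x = tup C E (map (\<lambda>j. proj C A n (\<delta> i j) \<cdot> x) [0..<m])"
    unfolding rho_def by (rule tup_comp[OF A p[OF i] x])
  finally show "proj C A n i \<cdot> fQ C n m \<delta> A D f \<cdot> \<langle>x, d\<rangle> =
      f \<cdot> \<langle>tup C E (map (\<lambda>j. proj C A n (\<delta> i j) \<cdot> x) [0..<m]), d\<rangle>" .
qed

lemma diag_cross_pair:
  assumes A: "A \<in> ob C" and D: "D \<in> ob C" and f: "f : pw C A m \<boxtimes> D \<leadsto> A"
  shows "f \<cdot> cross C (diag C A m) (ident C D) : A \<boxtimes> D \<leadsto> A"
    and "\<And>E x d. x : E \<leadsto> A \<Longrightarrow> d : E \<leadsto> D \<Longrightarrow>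
      (f \<cdot> cross C (diag C A m) (ident C D)) \<cdot> \<langle>x, d\<rangle> = f \<cdot> \<langle>tup C E (map (\<lambda>_. x) [0..<m]), d\<rangle>"
proof -
  note c = cross_hom[OF diag_hom[OF A] id_hom[OF D]]
  show "f \<cdot> cross C (diag C A m) (ident C D) : A \<boxtimes> D \<leadsto> A" by (rule comp_hom[OF f c])
  fix E x d assume x: "x : E \<leadsto> A" and d: "d : E \<leadsto> D"
  show "(f \<cdot> cross C (diag C A m) (ident C D)) \<cdot> \<langle>x, d\<rangle> = f \<cdot> \<langle>tup C E (map (\<lambda>_. x) [0..<m]), d\<rangle>"
    using assoc[OF f c pair_hom[OF x d]] cross_pair[OF diag_hom[OF A] id_hom[OF D] x d]
      diag_comp[OF A x] id_comp[OF d] by simp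
qed

end

section \<open>Systems of fixed point equations over automata with \<open>k\<close> letters\<close>

locale conway_term = conway C for C :: "('o, 'm, 'x) dag_cat_scheme" +
  fixes A D :: 'o and k :: nat and f :: 'm
  assumes A: "A \<in> ob C" and D: "D \<in> ob C" and f: "f : pw C A k \<boxtimes> D \<leadsto> A"
begin

text \<open>The domain \<open>E\<close> is an argument because the empty tuple is the terminal map
  out of \<open>E\<close>.\<close>

definition app :: "'o \<Rightarrow> (nat \<Rightarrow> 'm) \<Rightarrow> 'm \<Rightarrow> 'm" where
  "app E g d = f \<cdot> \<langle>tup C E (map g [0..<k]), d\<rangle>"

lemma app_hom:
  assumes g: "\<And>j. j < k \<Longrightarrow> g j : E \<leadsto> A" and d: "d : E \<leadsto> D"
  shows "app E g d : E \<leadsto> A"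
  unfolding app_def using hom_ob[OF d] by (intro comp_hom[OF f] pair_hom d tup_hom A g) auto

lemma app_comp:
  assumes g: "\<And>j. j < k \<Longrightarrow> g j : E \<leadsto> A" and d: "d : E \<leadsto> D" and x: "x : E' \<leadsto> E"
  shows "app E g d \<cdot> x = app E' (\<lambda>j. g j \<cdot> x) (d \<cdot> x)"
proof -
  have t: "tup C E (map g [0..<k]) : E \<leadsto> pw C A k"
    using hom_ob[OF d] by (intro tup_hom A g) auto
  show ?thesis
    unfolding app_def
    using assoc[OF f pair_hom[OF t d] x] pair_comp[OF t d x] tup_comp[OF A g x] by simp
qed

lemma app_cong: "(\<And>j. j < k \<Longrightarrow> g j = g' j) \<Longrightarrow> app E g d = app E g' d"
  unfolding app_def by (metis (mono_tags, lifting) map_eq_conv atLeastLessThan_iff set_upt)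

text \<open>\<open>F\<close> is the simultaneous right-hand side of the equations x_i = f(x_{act i
  0}, ..., x_{act i (k-1)}, d), one for each state \<open>i\<close>, read in an arbitrary power
  \<open>X\<close> of \<open>A\<close>.\<close>

definition system :: "'i set \<Rightarrow> ('i \<Rightarrow> nat \<Rightarrow> 'i) \<Rightarrow> 'o \<Rightarrow> ('i \<Rightarrow> 'm) \<Rightarrow> 'm \<Rightarrow> bool" where
  "system I act X v F \<longleftrightarrow> (\<forall>i\<in>I. \<forall>j<k. act i j \<in> I) \<and> is_power A X I v \<and> F : X \<boxtimes> D \<leadsto> X \<and>
     (\<forall>E x d. x : E \<leadsto> X \<longrightarrow> d : E \<leadsto> D \<longrightarrow>
        (\<forall>i\<in>I. v i \<cdot> F \<cdot> \<langle>x, d\<rangle> = app E (\<lambda>j. v (act i j) \<cdot> x) d))"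

text \<open>Not just any solution: \<open>s\<close> consists of the components of the dagger for
  some presentation of the system. By \<open>solves_subsystem\<close> for the identity map, its
  values on \<open>I\<close> do not depend on the presentation.\<close>

definition solves :: "'i set \<Rightarrow> ('i \<Rightarrow> nat \<Rightarrow> 'i) \<Rightarrow> ('i \<Rightarrow> 'm) \<Rightarrow> bool" where
  "solves I act s \<longleftrightarrow> (\<exists>X v F. system I act X v F \<and> (\<forall>i\<in>I. s i = v i \<cdot> dag C X D F))"

lemma systemD:
  assumes "system I act X v F"
  shows "\<And>i j. i \<in> I \<Longrightarrow> j < k \<Longrightarrow> act i j \<in> I" "is_power A X I v" "F : X \<boxtimes> D \<leadsto> X"
    and "\<And>E x d i. x : E \<leadsto> X \<Longrightarrow> d : E \<leadsto> D \<Longrightarrow> i \<in> I \<Longrightarrow>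
      v i \<cdot> F \<cdot> \<langle>x, d\<rangle> = app E (\<lambda>j. v (act i j) \<cdot> x) d"
  using assms unfolding system_def by simp_all

text \<open>A family of terms that is natural in its generalized elements is determined by its
  values at the two projections. These values are assembled into one morphism, and naturality gives
  all the others.\<close>

lemma power_system:
  assumes p: "is_power A Y I v" and X: "X \<in> ob C" and B: "B \<in> ob C"
    and g: "\<And>i. i \<in> I \<Longrightarrow> g i (X \<boxtimes> B) (pi1 C X B) (pi2 C X B) : X \<boxtimes> B \<leadsto> A"
    and nat: "\<And>i E x d. x : E \<leadsto> X \<Longrightarrow> d : E \<leadsto> B \<Longrightarrow> i \<in> I \<Longrightarrow>
       g i (X \<boxtimes> B) (pi1 C X B) (pi2 C X B) \<cdot> \<langle>x, d\<rangle> = g i E x d"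
  obtains F where "F : X \<boxtimes> B \<leadsto> Y"
    "\<And>E x d i. x : E \<leadsto> X \<Longrightarrow> d : E \<leadsto> B \<Longrightarrow> i \<in> I \<Longrightarrow> v i \<cdot> F \<cdot> \<langle>x, d\<rangle> = g i E x d"
proof -
  obtain F where F: "F : X \<boxtimes> B \<leadsto> Y" "\<And>i. i \<in> I \<Longrightarrow> v i \<cdot> F = g i (X \<boxtimes> B) (pi1 C X B) (pi2 C X B)"
    using power_tuple[OF p prod_ob[OF X B], of "\<lambda>i. g i (X \<boxtimes> B) (pi1 C X B) (pi2 C X B)"] g by metis
  show thesis
  proof (rule that[OF F(1)])
    fix E x d i assume x: "x : E \<leadsto> X" and d: "d : E \<leadsto> B" and i: "i \<in> I"
    show "v i \<cdot> F \<cdot> \<langle>x, d\<rangle> = g i E x d"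
      using assoc[OF power_hom[OF p i] F(1) pair_hom[OF x d]] F(2)[OF i] nat[OF x d i] by simp
  qed
qed

lemma app_natural:
  assumes u: "\<And>j. j < k \<Longrightarrow> u j : Z \<leadsto> A" and z: "z : B \<leadsto> Z" and w: "w : B \<leadsto> D" and y: "y : E \<leadsto> B"
  shows "app B (\<lambda>j. u j \<cdot> z) w \<cdot> y = app E (\<lambda>j. u j \<cdot> z \<cdot> y) (w \<cdot> y)"
proof -
  have "app B (\<lambda>j. u j \<cdot> z) w \<cdot> y = app E (\<lambda>j. (u j \<cdot> z) \<cdot> y) (w \<cdot> y)"
    by (rule app_comp[OF comp_hom[OF u z] w y])
  also have "\<dots> = app E (\<lambda>j. u j \<cdot> z \<cdot> y) (w \<cdot> y)"
    by (rule app_cong) (rule assoc[OF u z y])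
  finally show ?thesis .
qed

text \<open>By the double dagger identity, each variable on the right-hand sides of a system may be read
  either from the inner or from the outer of two nested fixed points: copies read inner variables,
  applications of \<open>f\<close> outer ones. The inner fixed point is then found by following copies.\<close>

lemma dag_eliminate_copies:
  assumes p: "is_power A X I v" and F: "F : X \<boxtimes> D \<leadsto> X"
    and Feq: "\<And>E x d i. x : E \<leadsto> X \<Longrightarrow> d : E \<leadsto> D \<Longrightarrow> i \<in> I \<Longrightarrow>
       v i \<cdot> F \<cdot> \<langle>x, d\<rangle> = (if cp i then v (nx i) \<cdot> x else app E (\<lambda>j. v (c i j) \<cdot> x) d)"
    and F': "system I' act' Y v' F'"
    and nx: "\<And>i. i \<in> I \<Longrightarrow> cp i \<Longrightarrow> nx i \<in> I \<and> \<psi> (nx i) = \<psi> i \<and> rank (nx i) < (rank i :: nat)"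
    and c: "\<And>i j. i \<in> I \<Longrightarrow> \<not> cp i \<Longrightarrow> j < k \<Longrightarrow> c i j \<in> I \<and> \<psi> (c i j) = act' (\<psi> i) j"
    and \<psi>: "\<And>i. i \<in> I \<Longrightarrow> \<psi> i \<in> I'" and s\<psi>: "\<And>i. i \<in> I \<Longrightarrow> \<not> cp i \<Longrightarrow> s (\<psi> i) = i"
    and s: "\<And>y. y \<in> I' \<Longrightarrow> s y \<in> I \<and> \<not> cp (s y) \<and> \<psi> (s y) = y"
    and i0: "i0 \<in> I"
  shows "v i0 \<cdot> dag C X D F = v' (\<psi> i0) \<cdot> dag C Y D F'"
proof -
  note X = power_ob[OF p] and v = power_hom[OF p]
  note p' = systemD(2)[OF F'] and F'_hom = systemD(3)[OF F']
  note Y = power_ob[OF p'] and v' = power_hom[OF p']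
  have XD: "X \<boxtimes> D \<in> ob C" by (rule prod_ob[OF X D])
  note q1 = pi1_hom[OF X D] and q2 = pi2_hom[OF X D]
  let ?g = "\<lambda>i E x b. if cp i then v (nx i) \<cdot> x
    else app E (\<lambda>j. v (c i j) \<cdot> pi1 C X D \<cdot> b) (pi2 C X D \<cdot> b)"
  note r1 = pi1_hom[OF X XD] and r2 = pi2_hom[OF X XD]
  obtain H where H: "H : X \<boxtimes> X \<boxtimes> D \<leadsto> X"
    and Heq: "\<And>E x b i. x : E \<leadsto> X \<Longrightarrow> b : E \<leadsto> X \<boxtimes> D \<Longrightarrow> i \<in> I \<Longrightarrow> v i \<cdot> H \<cdot> \<langle>x, b\<rangle> = ?g i E x b"
  proof (rule power_system[OF p X XD, of ?g])
    fix i assume i: "i \<in> I"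
    show "?g i (X \<boxtimes> X \<boxtimes> D) (pi1 C X (X \<boxtimes> D)) (pi2 C X (X \<boxtimes> D)) : X \<boxtimes> X \<boxtimes> D \<leadsto> A"
      using comp_hom[OF v r1] app_hom[OF comp_hom[OF v comp_hom[OF q1 r2]] comp_hom[OF q2 r2]] nx[OF i] c[OF i]
      by auto
    fix E x b assume x: "x : E \<leadsto> X" and b: "b : E \<leadsto> X \<boxtimes> D"
    note xb = pair_hom[OF x b]
    show "?g i (X \<boxtimes> X \<boxtimes> D) (pi1 C X (X \<boxtimes> D)) (pi2 C X (X \<boxtimes> D)) \<cdot> \<langle>x, b\<rangle> = ?g i E x b"
    proof (cases "cp i")
      case True
      then show ?thesis using assoc[OF v r1 xb] nx[OF i] pi1_pair[OF x b] by simp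
    next
      case False
      then show ?thesis
        using app_natural[of "\<lambda>j. v (c i j)", OF v comp_hom[OF q1 r2] comp_hom[OF q2 r2] xb]
          c[OF i] assoc[OF q1 r2 xb] assoc[OF q2 r2 xb] pi2_pair[OF x b] by simp
    qed
  qed (rule that)
  have W: "dag C X (X \<boxtimes> D) H : X \<boxtimes> D \<leadsto> X" (is "?W : _ \<leadsto> _") by (rule dag_hom[OF H X XD])
  have FH: "dag C X D F = dag C X D ?W"
  proof (rule dag_double[OF H F X D])
    fix E x d assume x: "x : E \<leadsto> X" and d: "d : E \<leadsto> D"
    note xd = pair_hom[OF x d]
    show "F \<cdot> \<langle>x, d\<rangle> = H \<cdot> \<langle>x, \<langle>x, d\<rangle>\<rangle>"
    proof (rule power_eqI[OF p comp_hom[OF F xd] comp_hom[OF H pair_hom[OF x xd]]])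
      fix i assume i: "i \<in> I"
      show "v i \<cdot> F \<cdot> \<langle>x, d\<rangle> = v i \<cdot> H \<cdot> \<langle>x, \<langle>x, d\<rangle>\<rangle>"
        using Feq[OF x d i] Heq[OF x xd i] pi1_pair[OF x d] pi2_pair[OF x d] by simp
    qed
  qed
  \<comment> \<open>Unfolding the inner fixed point once either reaches an application of
    \<open>f\<close> or moves to a variable of smaller \<open>rank\<close> with the same
    \<open>\<psi>\<close>. The search ends at \<open>s (\<psi> i)\<close>, the only variable over
    \<open>\<psi> i\<close> that is not a copy.\<close>
  have Weq: "v i \<cdot> ?W = app (X \<boxtimes> D) (\<lambda>j. v (c (s (\<psi> i)) j) \<cdot> pi1 C X D) (pi2 C X D)" if "i \<in> I" for i
    using that
  proof (induction "rank i" arbitrary: i rule: less_induct)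
    case less
    note i = less.prems
    have "v i \<cdot> ?W = v i \<cdot> H \<cdot> \<langle>?W, ident C (X \<boxtimes> D)\<rangle>"
      using dag_fixpoint[OF H X XD] by simp
    also have "\<dots> = ?g i (X \<boxtimes> D) ?W (ident C (X \<boxtimes> D))"
      by (rule Heq[OF W id_hom[OF XD] i])
    finally show ?case
      using less.hyps[of "nx i"] nx[OF i] s\<psi>[OF i] comp_id[OF q1] comp_id[OF q2] by (cases "cp i") simp_all
  qed
  have cs: "c (s y) j \<in> I" "\<psi> (c (s y) j) = act' y j" if "y \<in> I'" "j < k" for y j
    using s[OF that(1)] c[of "s y" j] that by simp_all
  let ?h = "\<lambda>y E x d. app E (\<lambda>j. v (c (s y) j) \<cdot> x) d"
  \<comment> \<open>\<open>L\<close> evaluates the application at the representative of each state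
    of the target system; \<open>T\<close>, obtained next, distributes a value to all variables over
    the same state. Up to the parameter, \<open>?W\<close> is \<open>T\<close> after
    \<open>L\<close> and \<open>F'\<close> is \<open>L\<close> after \<open>T\<close>, so the
    composition identity relates their daggers.\<close>
  obtain L where L: "L : X \<boxtimes> D \<leadsto> Y"
    and Leq: "\<And>E x d y. x : E \<leadsto> X \<Longrightarrow> d : E \<leadsto> D \<Longrightarrow> y \<in> I' \<Longrightarrow> v' y \<cdot> L \<cdot> \<langle>x, d\<rangle> = ?h y E x d"
  proof (rule power_system[OF p' X D, of ?h])
    fix y assume y: "y \<in> I'"
    note vc = v[OF cs(1)[OF y]]
    show "?h y (X \<boxtimes> D) (pi1 C X D) (pi2 C X D) : X \<boxtimes> D \<leadsto> A"
      by (rule app_hom[OF comp_hom[OF vc q1] q2])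
    fix E x d assume x: "x : E \<leadsto> X" and d: "d : E \<leadsto> D"
    show "?h y (X \<boxtimes> D) (pi1 C X D) (pi2 C X D) \<cdot> \<langle>x, d\<rangle> = ?h y E x d"
      using app_natural[of "\<lambda>j. v (c (s y) j)", OF vc q1 q2 pair_hom[OF x d]]
        pi1_pair[OF x d] pi2_pair[OF x d] by simp
  qed (rule that)
  have "\<And>i. i \<in> I \<Longrightarrow> v' (\<psi> i) : Y \<leadsto> A" by (rule v'[OF \<psi>])
  then obtain T where T: "T : Y \<leadsto> X" and Teq: "\<And>i. i \<in> I \<Longrightarrow> v i \<cdot> T = v' (\<psi> i)"
    using power_tuple[OF p Y, of "\<lambda>i. v' (\<psi> i)"] by metis
  note t1 = pi1_hom[OF Y D]
  have "dag C X D ?W = (T \<cdot> pi1 C Y D) \<cdot> \<langle>dag C Y D F', ident C D\<rangle>"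
  proof (rule dag_composition[OF comp_hom[OF T t1] L W F'_hom X Y D])
    fix E x d assume x: "x : E \<leadsto> X" and d: "d : E \<leadsto> D"
    note xd = pair_hom[OF x d]
    note Lxd = comp_hom[OF L xd]
    have "(T \<cdot> pi1 C Y D) \<cdot> \<langle>L \<cdot> \<langle>x, d\<rangle>, d\<rangle> = T \<cdot> L \<cdot> \<langle>x, d\<rangle>"
      using assoc[OF T t1 pair_hom[OF Lxd d]] pi1_pair[OF Lxd d] by simp
    moreover have "?W \<cdot> \<langle>x, d\<rangle> = T \<cdot> L \<cdot> \<langle>x, d\<rangle>"
    proof (rule power_eqI[OF p comp_hom[OF W xd] comp_hom[OF T Lxd]])
      fix i assume i: "i \<in> I"
      show "v i \<cdot> ?W \<cdot> \<langle>x, d\<rangle> = v i \<cdot> T \<cdot> L \<cdot> \<langle>x, d\<rangle>"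
        using assoc[OF v[OF i] W xd] assoc[OF v[OF i] T Lxd] Weq[OF i] Teq[OF i]
          app_natural[of "\<lambda>j. v (c (s (\<psi> i)) j)", OF v[OF cs(1)[OF \<psi>[OF i]]] q1 q2 xd]
          pi1_pair[OF x d] pi2_pair[OF x d] Leq[OF x d \<psi>[OF i]] by simp
    qed
    ultimately show "?W \<cdot> \<langle>x, d\<rangle> = (T \<cdot> pi1 C Y D) \<cdot> \<langle>L \<cdot> \<langle>x, d\<rangle>, d\<rangle>" by simp
  next
    fix E y d assume y: "y : E \<leadsto> Y" and d: "d : E \<leadsto> D"
    note yd = pair_hom[OF y d]
    note Ty = comp_hom[OF T y]
    note LTy = comp_hom[OF L pair_hom[OF Ty d]]
    have "(T \<cdot> pi1 C Y D) \<cdot> \<langle>y, d\<rangle> = T \<cdot> y"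
      using assoc[OF T t1 yd] pi1_pair[OF y d] by simp
    moreover have "F' \<cdot> \<langle>y, d\<rangle> = L \<cdot> \<langle>T \<cdot> y, d\<rangle>"
    proof (rule power_eqI[OF p' comp_hom[OF F'_hom yd] LTy])
      fix i assume i: "i \<in> I'"
      have "v (c (s i) j) \<cdot> T \<cdot> y = v' (act' i j) \<cdot> y" if "j < k" for j
        using assoc[OF v[OF cs(1)[OF i that]] T y] Teq[OF cs(1)[OF i that]] cs(2)[OF i that] by simp
      from app_cong[of "\<lambda>j. v (c (s i) j) \<cdot> T \<cdot> y", OF this]
      show "v' i \<cdot> F' \<cdot> \<langle>y, d\<rangle> = v' i \<cdot> L \<cdot> \<langle>T \<cdot> y, d\<rangle>"
        using Leq[OF Ty d i] systemD(4)[OF F' y d i] by simp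
    qed
    ultimately show "F' \<cdot> \<langle>y, d\<rangle> = L \<cdot> \<langle>(T \<cdot> pi1 C Y D) \<cdot> \<langle>y, d\<rangle>, d\<rangle>" by simp
  qed
  moreover note dF' = dag_hom[OF F'_hom Y D]
  moreover note assoc[OF T t1 pair_hom[OF dF' id_hom[OF D]]] pi1_pair[OF dF' id_hom[OF D]]
  ultimately have "dag C X D ?W = T \<cdot> dag C Y D F'" by simp
  then show ?thesis using FH assoc[OF v[OF i0] T dF'] Teq[OF i0] by simp
qed

text \<open>Here the equations of the subsystem read outer variables and the remaining ones inner
  variables, so that the inner fixed point depends on the subsystem only.\<close>

lemma dag_subsystem:
  assumes F: "system I act X v F" and F': "system I' act' Y v' F'"
    and \<phi>: "\<And>y. y \<in> I' \<Longrightarrow> \<phi> y \<in> I" and inj: "inj_on \<phi> I'"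
    and hom: "\<And>y j. y \<in> I' \<Longrightarrow> j < k \<Longrightarrow> \<phi> (act' y j) = act (\<phi> y) j"
    and y0: "y0 \<in> I'"
  shows "v (\<phi> y0) \<cdot> dag C X D F = v' y0 \<cdot> dag C Y D F'"
proof -
  note act = systemD(1)[OF F] and p = systemD(2)[OF F] and F_hom = systemD(3)[OF F]
  note X = power_ob[OF p] and v = power_hom[OF p]
  note act' = systemD(1)[OF F'] and p' = systemD(2)[OF F'] and F'_hom = systemD(3)[OF F']
  note Y = power_ob[OF p'] and v' = power_hom[OF p']
  have XD: "X \<boxtimes> D \<in> ob C" by (rule prod_ob[OF X D])
  note q1 = pi1_hom[OF X D] and q2 = pi2_hom[OF X D]
  let ?J = "\<phi> ` I'"
  let ?g = "\<lambda>i E x b. if i \<in> ?J then app E (\<lambda>j. v (act i j) \<cdot> pi1 C X D \<cdot> b) (pi2 C X D \<cdot> b)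
    else app E (\<lambda>j. v (act i j) \<cdot> x) (pi2 C X D \<cdot> b)"
  note r1 = pi1_hom[OF X XD] and r2 = pi2_hom[OF X XD]
  obtain H where H: "H : X \<boxtimes> X \<boxtimes> D \<leadsto> X"
    and Heq: "\<And>E x b i. x : E \<leadsto> X \<Longrightarrow> b : E \<leadsto> X \<boxtimes> D \<Longrightarrow> i \<in> I \<Longrightarrow> v i \<cdot> H \<cdot> \<langle>x, b\<rangle> = ?g i E x b"
  proof (rule power_system[OF p X XD, of ?g])
    fix i assume i: "i \<in> I"
    note va = v[OF act[OF i]]
    show "?g i (X \<boxtimes> X \<boxtimes> D) (pi1 C X (X \<boxtimes> D)) (pi2 C X (X \<boxtimes> D)) : X \<boxtimes> X \<boxtimes> D \<leadsto> A"
      using app_hom[OF comp_hom[OF va r1] comp_hom[OF q2 r2]]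
        app_hom[OF comp_hom[OF va comp_hom[OF q1 r2]] comp_hom[OF q2 r2]]
      by auto
    fix E x b assume x: "x : E \<leadsto> X" and b: "b : E \<leadsto> X \<boxtimes> D"
    note xb = pair_hom[OF x b]
    show "?g i (X \<boxtimes> X \<boxtimes> D) (pi1 C X (X \<boxtimes> D)) (pi2 C X (X \<boxtimes> D)) \<cdot> \<langle>x, b\<rangle> = ?g i E x b"
      using app_natural[of "\<lambda>j. v (act i j)", OF va comp_hom[OF q1 r2] comp_hom[OF q2 r2] xb]
        app_natural[of "\<lambda>j. v (act i j)", OF va r1 comp_hom[OF q2 r2] xb]
        assoc[OF q1 r2 xb] assoc[OF q2 r2 xb] pi1_pair[OF x b] pi2_pair[OF x b] by simp
  qed (rule that)
  have W: "dag C X (X \<boxtimes> D) H : X \<boxtimes> D \<leadsto> X" (is "?W : _ \<leadsto> _") by (rule dag_hom[OF H X XD])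
  have FH: "dag C X D F = dag C X D ?W"
  proof (rule dag_double[OF H F_hom X D])
    fix E x d assume x: "x : E \<leadsto> X" and d: "d : E \<leadsto> D"
    note xd = pair_hom[OF x d]
    show "F \<cdot> \<langle>x, d\<rangle> = H \<cdot> \<langle>x, \<langle>x, d\<rangle>\<rangle>"
    proof (rule power_eqI[OF p comp_hom[OF F_hom xd] comp_hom[OF H pair_hom[OF x xd]]])
      fix i assume i: "i \<in> I"
      show "v i \<cdot> F \<cdot> \<langle>x, d\<rangle> = v i \<cdot> H \<cdot> \<langle>x, \<langle>x, d\<rangle>\<rangle>"
        using systemD(4)[OF F x d i] Heq[OF x xd i] pi1_pair[OF x d] pi2_pair[OF x d] by simp
    qed
  qed
  have "\<And>y. y \<in> I' \<Longrightarrow> v (\<phi> y) : X \<leadsto> A" by (rule v[OF \<phi>])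
  then obtain R where R: "R : X \<leadsto> Y" and Req: "\<And>y. y \<in> I' \<Longrightarrow> v' y \<cdot> R = v (\<phi> y)"
    using power_tuple[OF p' X, of "\<lambda>y. v (\<phi> y)"] by metis
  \<comment> \<open>A left inverse of \<open>\<phi>\<close>, with \<open>y0\<close> as an arbitrary
    default. Consequently \<open>T\<close> after \<open>R\<close> keeps the variables in
    \<open>?J\<close> and overwrites all others by the one at \<open>\<phi> y0\<close>; the
    equations indexed by \<open>?J\<close> never read those others.\<close>
  define \<psi> where "\<psi> i = (if i \<in> ?J then the_inv_into I' \<phi> i else y0)" for i
  have \<psi>\<phi>: "\<psi> (\<phi> y) = y" if "y \<in> I'" for y
    using that inj by (simp add: \<psi>_def the_inv_into_f_f)
  have \<psi>: "\<psi> i \<in> I'" for i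
    using inj y0 by (auto simp: \<psi>_def the_inv_into_f_f)
  have "\<And>i. i \<in> I \<Longrightarrow> v' (\<psi> i) : Y \<leadsto> A" by (rule v'[OF \<psi>])
  then obtain T where T: "T : Y \<leadsto> X" and Teq: "\<And>i. i \<in> I \<Longrightarrow> v i \<cdot> T = v' (\<psi> i)"
    using power_tuple[OF p Y, of "\<lambda>i. v' (\<psi> i)"] by metis
  have TR: "v (\<phi> y) \<cdot> T \<cdot> R \<cdot> x = v (\<phi> y) \<cdot> x" if y: "y \<in> I'" and x: "x : E \<leadsto> X" for y E x
    using assoc[OF v[OF \<phi>[OF y]] T comp_hom[OF R x]] Teq[OF \<phi>[OF y]] \<psi>\<phi>[OF y]
      assoc[OF v'[OF y] R x] Req[OF y] by simp
  note TRh = comp_hom[OF T R]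
  let ?K = "cross C (T \<cdot> R) (ident C D)"
  have K: "?K : X \<boxtimes> D \<leadsto> X \<boxtimes> D" by (rule cross_hom[OF TRh id_hom[OF D]])
  \<comment> \<open>The outer parameter enters \<open>H\<close> only through its \<open>D\<close>
    component and, in the equations indexed by \<open>?J\<close>, through variables of
    \<open>?J\<close>, which is closed under the letters. Passing it through \<open>?K\<close>
    therefore changes nothing, and the parameter identity carries this over to
    \<open>?W\<close>.\<close>
  have WK: "?W = ?W \<cdot> ?K"
  proof (rule dag_parameter[OF H K H X])
    fix E x b assume x: "x : E \<leadsto> X" and b: "b : E \<leadsto> X \<boxtimes> D"
    note b1 = comp_hom[OF q1 b] and b2 = comp_hom[OF q2 b]
    note Kb = comp_hom[OF K b]
    have "b = \<langle>pi1 C X D \<cdot> b, pi2 C X D \<cdot> b\<rangle>" by (rule pair_eqI[OF b X D refl refl])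
    then have "?K \<cdot> b = \<langle>T \<cdot> R \<cdot> pi1 C X D \<cdot> b, pi2 C X D \<cdot> b\<rangle>"
      using cross_pair[OF TRh id_hom[OF D] b1 b2] id_comp[OF b2] assoc[OF T R b1] by simp
    moreover note pi1_pair[OF comp_hom[OF T comp_hom[OF R b1]] b2]
      pi2_pair[OF comp_hom[OF T comp_hom[OF R b1]] b2]
    ultimately have Kb1: "pi1 C X D \<cdot> ?K \<cdot> b = T \<cdot> R \<cdot> pi1 C X D \<cdot> b"
      and Kb2: "pi2 C X D \<cdot> ?K \<cdot> b = pi2 C X D \<cdot> b" by simp_all
    show "H \<cdot> \<langle>x, b\<rangle> = H \<cdot> \<langle>x, ?K \<cdot> b\<rangle>"
    proof (rule power_eqI[OF p comp_hom[OF H pair_hom[OF x b]] comp_hom[OF H pair_hom[OF x Kb]]])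
      fix i assume i: "i \<in> I"
      have "v (act i j) \<cdot> T \<cdot> R \<cdot> pi1 C X D \<cdot> b = v (act i j) \<cdot> pi1 C X D \<cdot> b" if iJ: "i \<in> ?J" and j: "j < k" for j
      proof -
        obtain y where y: "y \<in> I'" "i = \<phi> y" using iJ by blast
        then show ?thesis using TR[OF act'[OF y(1) j] b1] hom[OF y(1) j] by simp
      qed
      then show "v i \<cdot> H \<cdot> \<langle>x, b\<rangle> = v i \<cdot> H \<cdot> \<langle>x, ?K \<cdot> b\<rangle>"
        unfolding Heq[OF x b i] Heq[OF x Kb i] Kb1 Kb2 by (auto intro: app_cong)
    qed
  qed
  have Weq: "v (\<phi> y) \<cdot> ?W = app (X \<boxtimes> D) (\<lambda>j. v (act (\<phi> y) j) \<cdot> pi1 C X D) (pi2 C X D)"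
    if y: "y \<in> I'" for y
  proof -
    have "v (\<phi> y) \<cdot> ?W = v (\<phi> y) \<cdot> H \<cdot> \<langle>?W, ident C (X \<boxtimes> D)\<rangle>"
      using dag_fixpoint[OF H X XD] by simp
    also have "\<dots> = ?g (\<phi> y) (X \<boxtimes> D) ?W (ident C (X \<boxtimes> D))"
      by (rule Heq[OF W id_hom[OF XD] \<phi>[OF y]])
    finally show ?thesis using y comp_id[OF q1] comp_id[OF q2] by simp
  qed
  let ?N = "cross C T (ident C D)"
  have N: "?N : Y \<boxtimes> D \<leadsto> X \<boxtimes> D" by (rule cross_hom[OF T id_hom[OF D]])
  note WN = comp_hom[OF W N]
  have RWN: "F' \<cdot> \<langle>y, d\<rangle> = R \<cdot> (?W \<cdot> ?N) \<cdot> \<langle>y, d\<rangle>" if y: "y : E \<leadsto> Y" and d: "d : E \<leadsto> D" for E y d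
  proof -
    note yd = pair_hom[OF y d] and Ty = comp_hom[OF T y]
    note Tyd = pair_hom[OF Ty d]
    have 1: "(?W \<cdot> ?N) \<cdot> \<langle>y, d\<rangle> = ?W \<cdot> \<langle>T \<cdot> y, d\<rangle>"
      using assoc[OF W N yd] cross_pair[OF T id_hom[OF D] y d] id_comp[OF d] by simp
    show ?thesis
      unfolding 1
    proof (rule power_eqI[OF p' comp_hom[OF F'_hom yd] comp_hom[OF R comp_hom[OF W Tyd]]])
      fix i assume i: "i \<in> I'"
      have "v' i \<cdot> R \<cdot> ?W \<cdot> \<langle>T \<cdot> y, d\<rangle> = app E (\<lambda>j. v (act (\<phi> i) j) \<cdot> T \<cdot> y) d"
        using assoc[OF v'[OF i] R comp_hom[OF W Tyd]] Req[OF i] assoc[OF v[OF \<phi>[OF i]] W Tyd] Weq[OF i]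
          app_natural[of "\<lambda>j. v (act (\<phi> i) j)", OF v[OF act[OF \<phi>[OF i]]] q1 q2 Tyd]
          pi1_pair[OF Ty d] pi2_pair[OF Ty d] by simp
      also have "\<dots> = app E (\<lambda>j. v' (act' i j) \<cdot> y) d"
      proof (rule app_cong)
        fix j assume j: "j < k"
        show "v (act (\<phi> i) j) \<cdot> T \<cdot> y = v' (act' i j) \<cdot> y"
          using assoc[OF v[OF act[OF \<phi>[OF i] j]] T y] Teq[OF act[OF \<phi>[OF i] j]]
            hom[OF i j, symmetric] \<psi>\<phi>[OF act'[OF i j]] by simp
      qed
      finally show "v' i \<cdot> F' \<cdot> \<langle>y, d\<rangle> = v' i \<cdot> R \<cdot> ?W \<cdot> \<langle>T \<cdot> y, d\<rangle>"
        using systemD(4)[OF F' y d i] by simp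
    qed
  qed
  note dF' = dag_hom[OF F'_hom Y D]
  \<comment> \<open>By \<open>WK\<close>, \<open>?W\<close> is \<open>?W \<cdot> ?N\<close> after
    \<open>R\<close>, and by \<open>RWN\<close>, \<open>F'\<close> is \<open>R\<close> after
    \<open>?W \<cdot> ?N\<close>, in both cases up to the parameter. This is the shape required by
    the composition identity.\<close>
  have "dag C X D ?W = (?W \<cdot> ?N) \<cdot> \<langle>dag C Y D F', ident C D\<rangle>"
  proof (rule dag_composition[OF WN comp_hom[OF R q1] W F'_hom X Y D])
    fix E x d assume x: "x : E \<leadsto> X" and d: "d : E \<leadsto> D"
    note xd = pair_hom[OF x d] and Rx = comp_hom[OF R x]
    have "(R \<cdot> pi1 C X D) \<cdot> \<langle>x, d\<rangle> = R \<cdot> x"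
      using assoc[OF R q1 xd] pi1_pair[OF x d] by simp
    moreover have "(?W \<cdot> ?N) \<cdot> \<langle>R \<cdot> x, d\<rangle> = ?W \<cdot> \<langle>T \<cdot> R \<cdot> x, d\<rangle>"
      using assoc[OF W N pair_hom[OF Rx d]] cross_pair[OF T id_hom[OF D] Rx d] id_comp[OF d] by simp
    moreover have "(?W \<cdot> ?K) \<cdot> \<langle>x, d\<rangle> = ?W \<cdot> \<langle>T \<cdot> R \<cdot> x, d\<rangle>"
      using assoc[OF W K xd] cross_pair[OF TRh id_hom[OF D] x d] id_comp[OF d] assoc[OF T R x] by simp
    ultimately show "?W \<cdot> \<langle>x, d\<rangle> = (?W \<cdot> ?N) \<cdot> \<langle>(R \<cdot> pi1 C X D) \<cdot> \<langle>x, d\<rangle>, d\<rangle>"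
      using WK by simp
  next
    fix E y d assume y: "y : E \<leadsto> Y" and d: "d : E \<leadsto> D"
    note WNy = comp_hom[OF WN pair_hom[OF y d]]
    show "F' \<cdot> \<langle>y, d\<rangle> = (R \<cdot> pi1 C X D) \<cdot> \<langle>(?W \<cdot> ?N) \<cdot> \<langle>y, d\<rangle>, d\<rangle>"
      using RWN[OF y d] assoc[OF R q1 pair_hom[OF WNy d]] pi1_pair[OF WNy d] by simp
  qed
  \<comment> \<open>After projection to the subsystem, \<open>RWN\<close> leaves one unfolding of
    \<open>F'\<close> at its own dagger, which the fixed point equation removes.\<close>
  then have "R \<cdot> dag C X D ?W = F' \<cdot> \<langle>dag C Y D F', ident C D\<rangle>"
    using RWN[OF dF' id_hom[OF D]] by simp
  then have "R \<cdot> dag C X D F = dag C Y D F'"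
    using dag_fixpoint[OF F'_hom Y D] FH by simp
  then show ?thesis
    using assoc[OF v'[OF y0] R dag_hom[OF F_hom X D]] Req[OF y0] by simp
qed

section \<open>Comparing the solutions of different automata\<close>

lemma solvesE:
  assumes "solves I act s"
  obtains X v F where "system I act X v F" "\<And>i. i \<in> I \<Longrightarrow> s i = v i \<cdot> dag C X D F"
proof -
  obtain X v F where "system I act X v F \<and> (\<forall>i\<in>I. s i = v i \<cdot> dag C X D F)"
    using assms unfolding solves_def by (elim exE)
  then show thesis by (intro that[of X v F]) simp_all
qed

text \<open>\<open>dag_subsystem\<close> freed from presentations. It serves both to embed automata
  into products and to rebracket or rename the states of a product.\<close>

lemma solves_subsystem:
  assumes s: "solves I act s" and s': "solves I' act' s'"
    and \<phi>: "\<And>y. y \<in> I' \<Longrightarrow> \<phi> y \<in> I" and inj: "inj_on \<phi> I'"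
    and hom: "\<And>y j. y \<in> I' \<Longrightarrow> j < k \<Longrightarrow> \<phi> (act' y j) = act (\<phi> y) j"
    and y: "y \<in> I'"
  shows "s (\<phi> y) = s' y"
proof -
  obtain X v F where F: "system I act X v F" "\<And>i. i \<in> I \<Longrightarrow> s i = v i \<cdot> dag C X D F"
    by (rule solvesE[OF s]) (rule that)
  obtain Y v' F' where F': "system I' act' Y v' F'" "\<And>i. i \<in> I' \<Longrightarrow> s' i = v' i \<cdot> dag C Y D F'"
    by (rule solvesE[OF s']) (rule that)
  show ?thesis
    using dag_subsystem[where \<phi> = \<phi>, OF F(1) F'(1) \<phi> inj hom y] F(2)[OF \<phi>[OF y]] F'(2)[OF y] by simp
qed

lemma solves_ex:
  assumes fin: "finite I" and act: "\<And>i j. i \<in> I \<Longrightarrow> j < k \<Longrightarrow> act i j \<in> I"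
  obtains s where "solves I act s"
proof -
  obtain X v where p: "is_power A X I v" by (rule finite_power_ex[OF A fin])
  note X = power_ob[OF p] and v = power_hom[OF p]
  note q1 = pi1_hom[OF X D] and q2 = pi2_hom[OF X D]
  let ?g = "\<lambda>i E x d. app E (\<lambda>j. v (act i j) \<cdot> x) d"
  obtain F where F: "F : X \<boxtimes> D \<leadsto> X"
    "\<And>E x d i. x : E \<leadsto> X \<Longrightarrow> d : E \<leadsto> D \<Longrightarrow> i \<in> I \<Longrightarrow> v i \<cdot> F \<cdot> \<langle>x, d\<rangle> = ?g i E x d"
  proof (rule power_system[OF p X D, of ?g])
    fix i assume i: "i \<in> I"
    note va = v[OF act[OF i]]
    show "?g i (X \<boxtimes> D) (pi1 C X D) (pi2 C X D) : X \<boxtimes> D \<leadsto> A"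
      by (rule app_hom[OF comp_hom[OF va q1] q2])
    fix E x d assume x: "x : E \<leadsto> X" and d: "d : E \<leadsto> D"
    show "?g i (X \<boxtimes> D) (pi1 C X D) (pi2 C X D) \<cdot> \<langle>x, d\<rangle> = ?g i E x d"
      using app_natural[of "\<lambda>j. v (act i j)", OF va q1 q2 pair_hom[OF x d]]
        pi1_pair[OF x d] pi2_pair[OF x d] by simp
  qed (rule that)
  then have "system I act X v F" unfolding system_def using act p by simp
  then have "solves I act (\<lambda>i. v i \<cdot> dag C X D F)"
    unfolding solves_def by (intro exI conjI) (assumption, simp)
  then show thesis by (rule that)
qed

lemma solves_fQ:
  assumes act: "\<forall>i<l. \<forall>j<k. act i j < l"
  shows "solves {0..<l} act (\<lambda>i. proj C A l i \<cdot> dag C (pw C A l) D (fQ C l k act A D f))"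
proof -
  have "system {0..<l} act (pw C A l) (proj C A l) (fQ C l k act A D f)"
    unfolding system_def app_def
    using act power_pw[OF A] fQ_hom[OF A D f act] by simp
  then show ?thesis unfolding solves_def by (intro exI conjI) (assumption, simp)
qed

text \<open>With a single state all arguments of \<open>f\<close> are the same unknown, which is the
  effect of the diagonal. Together with \<open>solves_fQ\<close> this turns both sides of the
  automaton identities into solutions of systems.\<close>

lemma solves_diag:
  "solves {()} (\<lambda>_ _. ()) (\<lambda>_. dag C A D (f \<cdot> cross C (diag C A k) (ident C D)))"
proof -
  note c = diag_cross_pair[OF A D f]
  have "system {()} (\<lambda>_ _. ()) A (\<lambda>_. ident C A) (f \<cdot> cross C (diag C A k) (ident C D))"
    unfolding system_def app_def
    using power_singleton[OF A, of "()"] c id_comp[OF comp_hom[OF c(1) pair_hom]] by (simp add: id_comp)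
  moreover have "ident C A \<cdot> dag C A D (f \<cdot> cross C (diag C A k) (ident C D)) =
      dag C A D (f \<cdot> cross C (diag C A k) (ident C D))"
    by (rule id_comp[OF dag_hom[OF c(1) A D]])
  ultimately show ?thesis unfolding solves_def by (intro exI conjI) (assumption, simp)
qed

text \<open>At the state \<open>i\<close> of the automaton, the variable \<open>(r, x)\<close> of the auxiliary object stands for
  the unknown of the product at \<open>(ix, r)\<close>; for \<open>x = ay\<close> its equation is therefore a copy of
  \<open>(r, y)\<close> at \<open>\<delta> i a\<close>.\<close>

lemma Gamma_init_product:
  assumes Q: "automaton n m \<delta>" and q: "q < n" and \<Gamma>: "Gamma_init C n m \<delta> q"
    and w: "\<And>j. j < k \<Longrightarrow> w j \<noteq> [] \<and> set (w j) \<subseteq> {0..<m}" and u: "set u \<subseteq> {0..<m}"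
    and R: "finite R" and s: "solves R act s"
    and t: "solves ({0..<n} \<times> R) (\<lambda>(i, r) j. (run \<delta> i (w j), act r j)) t" and r0: "r0 \<in> R"
  shows "t (run \<delta> q u, r0) = s r0"
proof -
  have \<delta>: "\<delta> i a < n" if "i < n" "a < m" for i a using Q that unfolding automaton_def by simp
  note run = run_less[OF Q]
  obtain X1 v1 F1 where F1: "system R act X1 v1 F1" "\<And>r. r \<in> R \<Longrightarrow> s r = v1 r \<cdot> dag C X1 D F1"
    by (rule solvesE[OF s]) (rule that)
  obtain X2 v2 F2 where F2: "system ({0..<n} \<times> R) (\<lambda>(i, r) j. (run \<delta> i (w j), act r j)) X2 v2 F2"
    "\<And>y. y \<in> {0..<n} \<times> R \<Longrightarrow> t y = v2 y \<cdot> dag C X2 D F2"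
    by (rule solvesE[OF t]) (rule that)
  note act = systemD(1)[OF F1(1)]
  \<comment> \<open>\<open>S\<close> must be finite, closed under \<open>tl\<close>, and contain
    \<open>u\<close> and the tails of all \<open>w j\<close>. Words of bounded length do this, and
    the sum is a convenient bound for all lengths at once.\<close>
  define L where "L = length u + (\<Sum>j<k. length (w j))"
  define S where "S = {x. set x \<subseteq> {0..<m} \<and> length x \<le> L}"
  have uS: "u \<in> S" using u unfolding S_def L_def by simp
  have wS: "tl (w j) \<in> S" "hd (w j) < m" if j: "j < k" for j
  proof -
    have "length (w j) \<le> L"
      unfolding L_def using member_le_sum[of j "{..<k}" "\<lambda>j. length (w j)"] j by simp
    moreover obtain a x where "w j = a # x" using w[OF j] by (cases "w j") auto
    ultimately show "tl (w j) \<in> S" "hd (w j) < m" using w[OF j] unfolding S_def by auto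
  qed
  have nilS: "[] \<in> S" unfolding S_def by simp
  have tlS: "tl x \<in> S" "hd x < m" if "x \<in> S" "x \<noteq> []" for x
    using that unfolding S_def by (cases x; auto)+
  have "finite (R \<times> S)" using R finite_lists_length_le[of "{0..<m}" L] unfolding S_def by simp
  then obtain B vB where pB: "is_power A B (R \<times> S) vB" by (rule finite_power_ex[OF A])
  note B = power_ob[OF pB] and vB = power_hom[OF pB]
  note M = pw_ob[OF B, of m]
  note prj = proj_hom[OF B]
  note q1 = pi1_hom[OF M D] and q2 = pi2_hom[OF M D]
  \<comment> \<open>\<open>F0\<close> can access its variables only through one of the
    \<open>m\<close> letters. A copy at a nonempty word spends the first letter; at the empty word
    \<open>f\<close> is applied, and argument \<open>j\<close> spends the first letter of
    \<open>w j\<close> and leaves the tail as a copy. This is where the words have to be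
    nonempty.\<close>
  let ?g = "\<lambda>(r, x) E y d. if x \<noteq> [] then (vB (r, tl x) \<cdot> proj C B m (hd x)) \<cdot> y
    else app E (\<lambda>j. (vB (act r j, tl (w j)) \<cdot> proj C B m (hd (w j))) \<cdot> y) d"
  have copy: "vB (r, tl x) \<cdot> proj C B m (hd x) : pw C B m \<leadsto> A" if "r \<in> R" "x \<in> S" "x \<noteq> []" for r x
    using comp_hom[OF vB prj] tlS that by simp
  have appl: "vB (act r j, tl (w j)) \<cdot> proj C B m (hd (w j)) : pw C B m \<leadsto> A" if "r \<in> R" "j < k" for r j
    using comp_hom[OF vB prj] wS act that by simp
  obtain F0 where F0: "F0 : pw C B m \<boxtimes> D \<leadsto> B"
    and F0eq: "\<And>E y d i. y : E \<leadsto> pw C B m \<Longrightarrow> d : E \<leadsto> D \<Longrightarrow> i \<in> R \<times> S \<Longrightarrow> vB i \<cdot> F0 \<cdot> \<langle>y, d\<rangle> = ?g i E y d"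
  proof (rule power_system[OF pB M D, of ?g])
    fix i assume "i \<in> R \<times> S"
    then obtain r x where i: "i = (r, x)" "r \<in> R" "x \<in> S" by blast
    show "?g i (pw C B m \<boxtimes> D) (pi1 C (pw C B m) D) (pi2 C (pw C B m) D) : pw C B m \<boxtimes> D \<leadsto> A"
      using comp_hom[OF copy q1] app_hom[OF comp_hom[OF appl q1] q2] i by auto
    fix E y d assume y: "y : E \<leadsto> pw C B m" and d: "d : E \<leadsto> D"
    note yd = pair_hom[OF y d]
    show "?g i (pw C B m \<boxtimes> D) (pi1 C (pw C B m) D) (pi2 C (pw C B m) D) \<cdot> \<langle>y, d\<rangle> = ?g i E y d"
    proof (cases "x = []")
      case True
      then show ?thesis
        using app_natural[of "\<lambda>j. vB (act r j, tl (w j)) \<cdot> proj C B m (hd (w j))", OF appl[OF i(2)] q1 q2 yd]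
          i(1) pi1_pair[OF y d] pi2_pair[OF y d] by simp
    next
      case False
      then show ?thesis
        using assoc[OF copy[OF i(2,3)] q1 yd] i(1) pi1_pair[OF y d] by simp
    qed
  qed (rule that)
  \<comment> \<open>The arguments \<open>h\<close> are arbitrary because two readings follow: the
    values at the successors of a state for \<open>fQ\<close>, and one constant value for the
    diagonal.\<close>
  have F0tup: "vB (r, x) \<cdot> F0 \<cdot> \<langle>tup C E (map h [0..<m]), d\<rangle> =
      (if x \<noteq> [] then vB (r, tl x) \<cdot> h (hd x) else app E (\<lambda>j. vB (act r j, tl (w j)) \<cdot> h (hd (w j))) d)"
    if h: "\<And>a. a < m \<Longrightarrow> h a : E \<leadsto> B" and d: "d : E \<leadsto> D" and r: "r \<in> R" and x: "x \<in> S" for E h d r x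
  proof -
    have E: "E \<in> ob C" using hom_ob[OF d] by simp
    have T: "tup C E (map h [0..<m]) : E \<leadsto> pw C B m" by (rule tup_hom[OF B E h])
    have rx: "(r, x) \<in> R \<times> S" using r x by simp
    have eq: "(vB \<kappa> \<cdot> proj C B m a) \<cdot> tup C E (map h [0..<m]) = vB \<kappa> \<cdot> h a" if "\<kappa> \<in> R \<times> S" "a < m" for \<kappa> a
      using assoc[OF vB[OF that(1)] prj[OF that(2)] T] proj_tup[OF B E h that(2)] by simp
    have "app E (\<lambda>j. (vB (act r j, tl (w j)) \<cdot> proj C B m (hd (w j))) \<cdot> tup C E (map h [0..<m])) d =
        app E (\<lambda>j. vB (act r j, tl (w j)) \<cdot> h (hd (w j))) d"
      using eq act[OF r] wS by (intro app_cong) simp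
    then show ?thesis
      using F0eq[OF T d rx] r x eq[of "(r, tl x)" "hd x"] tlS[OF x] by simp
  qed
  let ?v = "\<lambda>(i, \<kappa>). vB \<kappa> \<cdot> proj C B n i"
  have "\<forall>i<n. \<forall>a<m. \<delta> i a < n" using \<delta> by simp
  note fQ = fQ_hom[OF B D F0 this]
  \<comment> \<open>The variable \<open>(i, r, x)\<close> resolves to the product state
    \<open>(run \<delta> i x, r)\<close>. Every copy consumes a letter, so the length of the word is
    the rank, and the representatives are the variables with empty word.\<close>
  have "?v (q, r0, u) \<cdot> dag C (pw C B n) D (fQ C n m \<delta> B D F0) =
      v2 ((\<lambda>(i, r, x). (run \<delta> i x, r)) (q, r0, u)) \<cdot> dag C X2 D F2"
  proof (rule dag_eliminate_copies[OF power_power[OF pB power_pw[OF B]] fQ(1) _ F2(1),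
        where cp = "\<lambda>(i, r, x). x \<noteq> []" and nx = "\<lambda>(i, r, x). (\<delta> i (hd x), r, tl x)"
          and c = "\<lambda>(i, r, x) j. (\<delta> i (hd (w j)), act r j, tl (w j))"
          and rank = "\<lambda>(i, r, x). length x" and s = "\<lambda>(i, r). (i, r, [])"])
    fix E y d \<iota> assume y: "y : E \<leadsto> pw C B n" and d: "d : E \<leadsto> D" and "\<iota> \<in> {0..<n} \<times> R \<times> S"
    then obtain i r x where \<iota>: "\<iota> = (i, r, x)" and i: "i < n" and r: "r \<in> R" and x: "x \<in> S" by auto
    note yd = pair_hom[OF y d]
    have rx: "(r, x) \<in> R \<times> S" using r x by simp
    have py: "proj C B n (\<delta> i a) \<cdot> y : E \<leadsto> B" if "a < m" for a
      by (rule comp_hom[OF prj[OF \<delta>[OF i that]] y])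
    have as: "(vB \<kappa> \<cdot> proj C B n (\<delta> i a)) \<cdot> y = vB \<kappa> \<cdot> proj C B n (\<delta> i a) \<cdot> y"
      if "\<kappa> \<in> R \<times> S" "a < m" for \<kappa> a
      by (rule assoc[OF vB[OF that(1)] prj[OF \<delta>[OF i that(2)]] y])
    have ap: "app E (\<lambda>j. (vB (act r j, tl (w j)) \<cdot> proj C B n (\<delta> i (hd (w j)))) \<cdot> y) d =
        app E (\<lambda>j. vB (act r j, tl (w j)) \<cdot> proj C B n (\<delta> i (hd (w j))) \<cdot> y) d"
      using as act[OF r] wS by (intro app_cong) simp
    have "(vB (r, x) \<cdot> proj C B n i) \<cdot> fQ C n m \<delta> B D F0 \<cdot> \<langle>y, d\<rangle> =
        vB (r, x) \<cdot> F0 \<cdot> \<langle>tup C E (map (\<lambda>j. proj C B n (\<delta> i j) \<cdot> y) [0..<m]), d\<rangle>"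
      using assoc[OF vB[OF rx] prj[OF i] comp_hom[OF fQ(1) yd]] fQ(2)[OF y d i] by simp
    also have "\<dots> = (if x \<noteq> [] then vB (r, tl x) \<cdot> proj C B n (\<delta> i (hd x)) \<cdot> y
        else app E (\<lambda>j. vB (act r j, tl (w j)) \<cdot> proj C B n (\<delta> i (hd (w j))) \<cdot> y) d)"
      by (rule F0tup[OF py d r x])
    finally show "?v \<iota> \<cdot> fQ C n m \<delta> B D F0 \<cdot> \<langle>y, d\<rangle> =
       (if (\<lambda>(i, r, x). x \<noteq> []) \<iota> then ?v ((\<lambda>(i, r, x). (\<delta> i (hd x), r, tl x)) \<iota>) \<cdot> y
        else app E (\<lambda>j. ?v ((\<lambda>(i, r, x) j. (\<delta> i (hd (w j)), act r j, tl (w j))) \<iota> j) \<cdot> y) d)"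
      using \<iota> as[of "(r, tl x)" "hd x"] ap r tlS[OF x] by simp
  next
    fix \<iota> assume "\<iota> \<in> {0..<n} \<times> R \<times> S" and "(\<lambda>(i, r, x). x \<noteq> []) \<iota>"
    then obtain i r a x where "\<iota> = (i, r, a # x)" "i < n" "r \<in> R" "a # x \<in> S"
      by (auto simp: neq_Nil_conv)
    then show "(\<lambda>(i, r, x). (\<delta> i (hd x), r, tl x)) \<iota> \<in> {0..<n} \<times> R \<times> S \<and>
        (\<lambda>(i, r, x). (run \<delta> i x, r)) ((\<lambda>(i, r, x). (\<delta> i (hd x), r, tl x)) \<iota>) =
        (\<lambda>(i, r, x). (run \<delta> i x, r)) \<iota> \<and>
        (\<lambda>(i, r, x). length x) ((\<lambda>(i, r, x). (\<delta> i (hd x), r, tl x)) \<iota>) < (\<lambda>(i, r, x). length x) \<iota>"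
      using tlS[of "a # x"] \<delta> by (simp add: run_def)
  next
    fix \<iota> j assume "\<iota> \<in> {0..<n} \<times> R \<times> S" "\<not> (\<lambda>(i, r, x). x \<noteq> []) \<iota>" and j: "j < k"
    then obtain i r where "\<iota> = (i, r, [])" "i < n" "r \<in> R" by auto
    moreover have "run \<delta> (\<delta> i (hd (w j))) (tl (w j)) = run \<delta> i (w j)" for i
      using w[OF j] by (cases "w j") (simp_all add: run_def)
    ultimately show "(\<lambda>(i, r, x) j. (\<delta> i (hd (w j)), act r j, tl (w j))) \<iota> j \<in> {0..<n} \<times> R \<times> S \<and>
        (\<lambda>(i, r, x). (run \<delta> i x, r)) ((\<lambda>(i, r, x) j. (\<delta> i (hd (w j)), act r j, tl (w j))) \<iota> j) =
        (\<lambda>(i, r) j. (run \<delta> i (w j), act r j)) ((\<lambda>(i, r, x). (run \<delta> i x, r)) \<iota>) j"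
      using wS[OF j] act j \<delta> by (simp add: run_def)
  next
    show "(\<lambda>(i, r, x). (run \<delta> i x, r)) \<iota> \<in> {0..<n} \<times> R" if "\<iota> \<in> {0..<n} \<times> R \<times> S" for \<iota>
      using that by (auto simp: S_def run)
  qed (use q r0 uS in \<open>auto simp: run_def nilS\<close>)
  moreover have "proj C B n q \<cdot> dag C (pw C B n) D (fQ C n m \<delta> B D F0) =
      dag C B D (F0 \<cdot> cross C (diag C B m) (ident C D))"
    using \<Gamma>[unfolded Gamma_init_def, rule_format, OF B D F0] .
  moreover have "(r0, u) \<in> R \<times> S" using r0 uS by simp
  note assoc[OF vB[OF this] prj[OF q] dag_hom[OF fQ(1) pw_ob[OF B] D]]
  ultimately have tq: "vB (r0, u) \<cdot> dag C B D (F0 \<cdot> cross C (diag C B m) (ident C D)) = t (run \<delta> q u, r0)"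
    using r0 uS F2(2)[of "(run \<delta> q u, r0)"] run[OF q u] by simp
  note dg = diag_cross_pair[OF B D F0]
  \<comment> \<open>Along the diagonal all letters read the same variable, so the state of the
    automaton disappears and \<open>(r, x)\<close> resolves to \<open>r\<close> alone.\<close>
  have "vB (r0, u) \<cdot> dag C B D (F0 \<cdot> cross C (diag C B m) (ident C D)) =
      v1 (fst (r0, u)) \<cdot> dag C X1 D F1"
  proof (rule dag_eliminate_copies[OF pB dg(1) _ F1(1),
        where cp = "\<lambda>(r, x). x \<noteq> []" and nx = "\<lambda>(r, x). (r, tl x)"
          and c = "\<lambda>(r, x) j. (act r j, tl (w j))"
          and rank = "\<lambda>(r, x). length x" and s = "\<lambda>r. (r, [])"])
    fix E y d \<iota> assume y: "y : E \<leadsto> B" and d: "d : E \<leadsto> D" and "\<iota> \<in> R \<times> S"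
    then obtain r x where "\<iota> = (r, x)" and r: "r \<in> R" and x: "x \<in> S" by auto
    then show "vB \<iota> \<cdot> (F0 \<cdot> cross C (diag C B m) (ident C D)) \<cdot> \<langle>y, d\<rangle> =
       (if (\<lambda>(r, x). x \<noteq> []) \<iota> then vB ((\<lambda>(r, x). (r, tl x)) \<iota>) \<cdot> y
        else app E (\<lambda>j. vB ((\<lambda>(r, x) j. (act r j, tl (w j))) \<iota> j) \<cdot> y) d)"
      using dg(2)[OF y d] F0tup[of "\<lambda>_. y", OF y d r x] by simp
  qed (use r0 uS in \<open>auto simp: nilS act wS tlS\<close>)
  then show ?thesis using tq F1(2)[OF r0] by simp
qed

section \<open>Powers of the automaton and sets of transformations\<close>

text \<open>Induction on \<open>l\<close>, removing one factor at a time: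
  \<open>Gamma_init_product\<close> allows any second factor, so the shorter lists paired with
  \<open>R\<close> can take that place. Initial connectedness supplies, for each entry of
  \<open>ps\<close>, a word leading to it from \<open>q\<close>.\<close>

lemma Gamma_init_power:
  assumes Q: "automaton n m \<delta>" and q: "q < n" and conn: "initially_connected n m \<delta> q"
    and \<Gamma>: "Gamma_init C n m \<delta> q"
    and w: "\<And>j. j < k \<Longrightarrow> w j \<noteq> [] \<and> set (w j) \<subseteq> {0..<m}"
    and R: "finite R" and act: "\<And>r j. r \<in> R \<Longrightarrow> j < k \<Longrightarrow> act r j \<in> R" and s: "solves R act s"
    and t: "solves ({ps. set ps \<subseteq> {0..<n} \<and> length ps = l} \<times> R)
        (\<lambda>(ps, r) j. (map (\<lambda>p. run \<delta> p (w j)) ps, act r j)) t"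
    and "set ps \<subseteq> {0..<n}" "length ps = l" "r \<in> R"
  shows "t (ps, r) = s r"
  using t assms(10-)
proof (induction l arbitrary: ps t)
  case 0
  \<comment> \<open>Only the empty list occurs in the first factor, so the second projection is
    injective.\<close>
  have "s (snd (ps, r)) = t (ps, r)"
    by (rule solves_subsystem[OF s "0.prems"(1)]) (use 0 in \<open>auto simp: inj_on_def\<close>)
  then show ?case by simp
next
  case (Suc l)
  let ?P = "\<lambda>l. {ps. set ps \<subseteq> {0..<n} \<and> length ps = l}"
  let ?a = "\<lambda>(ps, r) j. (map (\<lambda>p. run \<delta> p (w j)) ps, act r j)"
  have run: "run \<delta> i (w j) < n" if "i < n" "j < k" for i j using run_less[OF Q] that w by simp
  have fin: "finite (?P l \<times> R)" using R finite_lists_length_eq[of "{0..<n}" l] by simp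
  have closed: "?a y j \<in> ?P l \<times> R" if "y \<in> ?P l \<times> R" "j < k" for y j
    using that by (auto simp: act subset_iff intro!: run)
  obtain t1 where t1: "solves (?P l \<times> R) ?a t1"
    using solves_ex[where act = ?a, OF fin closed] by blast
  have fin2: "finite ({0..<n} \<times> ?P l \<times> R)" by (rule finite_cartesian_product[OF _ fin]) simp
  have closed2: "(\<lambda>(i, y) j. (run \<delta> i (w j), ?a y j)) y j \<in> {0..<n} \<times> ?P l \<times> R"
    if "y \<in> {0..<n} \<times> ?P l \<times> R" "j < k" for y j
    using that by (auto simp: act subset_iff intro!: run)
  obtain t2 where t2: "solves ({0..<n} \<times> ?P l \<times> R) (\<lambda>(i, y) j. (run \<delta> i (w j), ?a y j)) t2"
    using solves_ex[where act = "\<lambda>(i, y) j. (run \<delta> i (w j), ?a y j)", OF fin2 closed2] by blast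
  obtain p ps' where ps: "ps = p # ps'" "p < n" "set ps' \<subseteq> {0..<n}" "length ps' = l"
    using Suc.prems by (cases ps) auto
  obtain u where u: "set u \<subseteq> {0..<m}" "run \<delta> q u = p"
    using conn ps(2) unfolding initially_connected_def by blast
  \<comment> \<open>Separating head and tail is an injective morphism from the lists of length
    \<open>Suc l\<close>, paired with \<open>R\<close>, into the nested product.\<close>
  have "t2 ((\<lambda>(ps, r). (hd ps, tl ps, r)) (ps, r)) = t (ps, r)"
    by (rule solves_subsystem[OF t2 Suc.prems(1)])
      (use Suc.prems in \<open>auto simp: inj_on_def length_Suc_conv\<close>)
  moreover have "t2 (run \<delta> q u, ps', r) = t1 (ps', r)"
    by (rule Gamma_init_product[OF Q q \<Gamma> w u(1) fin t1 t2]) (use ps \<open>r \<in> R\<close> in simp_all)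
  ultimately show ?case using Suc.IH[OF t1 ps(3,4) \<open>r \<in> R\<close>] ps(1) u(2) by simp
qed

text \<open>A transformation in \<open>H\<close> is determined by the list of its values. Pairing
  this list with \<open>h x\<close> therefore embeds \<open>H\<close> into a product even if
  \<open>h\<close> identifies elements, and \<open>Gamma_init_power\<close> then discards the
  list.\<close>

lemma Gamma_init_transformations:
  assumes Q: "automaton n m \<delta>" and q: "q < n" and conn: "initially_connected n m \<delta> q"
    and \<Gamma>: "Gamma_init C n m \<delta> q"
    and w: "\<And>j. j < k \<Longrightarrow> w j \<noteq> [] \<and> set (w j) \<subseteq> {0..<m}"
    and H: "H \<subseteq> {0..<n} \<rightarrow>\<^sub>E {0..<n}"
    and sH: "solves H (\<lambda>x j. \<lambda>p\<in>{0..<n}. run \<delta> (x p) (w j)) sH"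
    and R: "finite R" and act: "\<And>r j. r \<in> R \<Longrightarrow> j < k \<Longrightarrow> act r j \<in> R" and s: "solves R act s"
    and h: "\<And>x. x \<in> H \<Longrightarrow> h x \<in> R"
    and hom: "\<And>x j. x \<in> H \<Longrightarrow> j < k \<Longrightarrow> h (\<lambda>p\<in>{0..<n}. run \<delta> (x p) (w j)) = act (h x) j"
    and x: "x \<in> H"
  shows "sH x = s (h x)"
proof -
  let ?P = "{ps. set ps \<subseteq> {0..<n} \<and> length ps = n}"
  let ?a = "\<lambda>(ps, r) j. (map (\<lambda>p. run \<delta> p (w j)) ps, act r j)"
  have run: "run \<delta> i (w j) < n" if "i < n" "j < k" for i j using run_less[OF Q] that w by simp
  have fin: "finite (?P \<times> R)" using R finite_lists_length_eq[of "{0..<n}" n] by simp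
  have closed: "?a y j \<in> ?P \<times> R" if "y \<in> ?P \<times> R" "j < k" for y j
    using that by (cases y) (simp add: act image_subset_iff, simp add: subset_iff run)
  obtain t where t: "solves (?P \<times> R) ?a t"
    using solves_ex[where act = ?a, OF fin closed] by blast
  let ?\<phi> = "\<lambda>x. (map x [0..<n], h x)"
  have \<phi>: "?\<phi> y \<in> ?P \<times> R" if "y \<in> H" for y
    using that H h by auto
  have "t (?\<phi> x) = sH x"
  proof (rule solves_subsystem[where \<phi> = ?\<phi>, OF t sH \<phi> _ _ x])
    show "inj_on ?\<phi> H"
    proof (rule inj_onI)
      fix y z assume yz: "y \<in> H" "z \<in> H" "?\<phi> y = ?\<phi> z"
      then have "y \<in> extensional {0..<n}" "z \<in> extensional {0..<n}" using H by (auto simp: PiE_iff)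
      moreover have "y p = z p" if "p \<in> {0..<n}" for p using yz(3) that by simp
      ultimately show "y = z" by (rule extensionalityI)
    qed
    show "?\<phi> (\<lambda>p\<in>{0..<n}. run \<delta> (y p) (w j)) = ?a (?\<phi> y) j" if "y \<in> H" "j < k" for y j
      using that by (simp add: hom)
  qed
  moreover have "t (map x [0..<n], h x) = s (h x)"
    by (rule Gamma_init_power[OF Q q conn \<Gamma> w R act s t]) (use \<phi>[OF x] in simp_all)
  ultimately show ?thesis by simp
qed

end

section \<open>Groups in the transformation monoid and the group identity\<close>

text \<open>Only the empty word needs replacing. It induces the identity, which is idempotent and
  hence equals the unit of \<open>H\<close>. The product of the non-unit \<open>y\<close> with its
  inverse is the same transformation, and the word for \<open>y\<close> cannot be empty.\<close>

lemma nonempty_word: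
  assumes Q: "automaton n m \<delta>" and sub: "H \<subseteq> trans_monoid n m \<delta>" and grp: "group \<lparr>carrier = H, monoid.mult = tm_mult n, one = e\<rparr>"
    and nontriv: "y \<in> H" "y \<noteq> e" and x: "x \<in> H"
  obtains u where "u \<noteq> []" "set u \<subseteq> {0..<m}" "x = (\<lambda>p\<in>{0..<n}. run \<delta> p u)"
proof -
  interpret group "\<lparr>carrier = H, monoid.mult = tm_mult n, one = e\<rparr>" by (rule grp)
  have word: "\<exists>u. set u \<subseteq> {0..<m} \<and> z = (\<lambda>p\<in>{0..<n}. run \<delta> p u)" if "z \<in> H" for z
    using sub that unfolding trans_monoid_def by blast
  obtain u where u: "set u \<subseteq> {0..<m}" "x = (\<lambda>p\<in>{0..<n}. run \<delta> p u)" using word[OF x] by blast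
  show thesis
  proof (cases "u = []")
    case False
    then show thesis using that u by blast
  next
    case True
    then have x_id: "x = (\<lambda>p\<in>{0..<n}. p)" using u by (simp add: run_def)
    then have "tm_mult n x x = x" unfolding tm_mult_def compose_def by auto
    then have x_e: "x = e" using l_cancel_one[of x x] x by simp
    obtain v where v: "set v \<subseteq> {0..<m}" "y = (\<lambda>p\<in>{0..<n}. run \<delta> p v)" using word[OF nontriv(1)] by blast
    have "v \<noteq> []" using v nontriv(2) x_e x_id by (auto simp: run_def)
    obtain y' where y': "y' \<in> H" "tm_mult n y y' = e"
      using r_inv_ex[of y] nontriv(1) by auto
    obtain v' where v': "set v' \<subseteq> {0..<m}" "y' = (\<lambda>p\<in>{0..<n}. run \<delta> p v')" using word[OF y'(1)] by blast
    have "x = (\<lambda>p\<in>{0..<n}. run \<delta> p (v @ v'))"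
      unfolding x_e y'(2)[symmetric] unfolding tm_mult_def compose_def v v'
      using run_less[OF Q _ v(1)] by (auto simp: run_def)
    then show thesis using that[of "v @ v'"] \<open>v \<noteq> []\<close> v(1) v'(1) by simp
  qed
qed

theorem theorem3p4:
  fixes C :: "('o, 'm, 'x) dag_cat_scheme"
    and n m :: nat and \<delta> :: "nat \<Rightarrow> nat \<Rightarrow> nat" and q :: nat
  assumes "conway_category C"
    and "automaton n m \<delta>" and "q < n"
    and "initially_connected n m \<delta> q"
    and "Gamma_init C n m \<delta> q"
  shows "\<forall>G :: ('g, 'b) monoid_scheme.
           group G \<and> finite (carrier G) \<and> simple_group G \<and> group_divides_tm G n m \<delta>
           \<longrightarrow> Gamma_group C G"
proof (intro allI impI, elim conjE)
  fix G :: "('g, 'b) monoid_scheme"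
  assume "group G" and finG: "finite (carrier G)" and simple: "simple_group G"
    and div: "group_divides_tm G n m \<delta>"
  interpret G: group G by fact
  obtain H e\<^sub>H h where sub: "H \<subseteq> trans_monoid n m \<delta>"
    and grp: "group \<lparr>carrier = H, monoid.mult = tm_mult n, one = e\<^sub>H\<rparr>"
    and hom: "h \<in> hom \<lparr>carrier = H, monoid.mult = tm_mult n, one = e\<^sub>H\<rparr> G" and onto: "h ` H = carrier G"
    using div unfolding group_divides_tm_def by (elim exE conjE)
  interpret H: group "\<lparr>carrier = H, monoid.mult = tm_mult n, one = e\<^sub>H\<rparr>" by (rule grp)
  have h_mult: "h (tm_mult n x y) = h x \<otimes>\<^bsub>G\<^esub> h y" if "x \<in> H" "y \<in> H" for x y
    using hom that unfolding hom_def by auto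
  have H_mult: "tm_mult n x y \<in> H" if "x \<in> H" "y \<in> H" for x y
    using H.m_closed[of x y] that by simp
  \<comment> \<open>A simple group has more than one element, hence so does its preimage
    \<open>H\<close>. This provides the non-unit that \<open>nonempty_word\<close> asks for.\<close>
  have "\<not> H \<subseteq> {e\<^sub>H}"
  proof
    assume "H \<subseteq> {e\<^sub>H}"
    then have "carrier G \<subseteq> {h e\<^sub>H}" using onto by auto
    then have "card (carrier G) \<le> 1" using card_mono[of "{h e\<^sub>H}"] by auto
    then show False using simple_group.order_gt_one[OF simple] unfolding order_def by simp
  qed
  then obtain y where y: "y \<in> H" "y \<noteq> e\<^sub>H" by blast
  have HE: "H \<subseteq> {0..<n} \<rightarrow>\<^sub>E {0..<n}"
    using sub run_less[OF assms(2)] unfolding trans_monoid_def by fastforce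
  then have finH: "finite H" by (rule finite_subset) (simp add: finite_PiE)
  show "Gamma_group C G"
    unfolding Gamma_group_def
  proof (intro allI impI)
    fix e assume e: "bij_betw e {0..<card (carrier G)} (carrier G)"
    define N where "N = card (carrier G)"
    define ei where "ei = inv_into {0..<N} e"
    have e_carrier: "e i \<in> carrier G" if "i < N" for i
      using e that unfolding N_def bij_betw_def by auto
    have ei: "ei g < N" "e (ei g) = g" if "g \<in> carrier G" for g
      using e that unfolding N_def ei_def bij_betw_def
      by (metis atLeastLessThan_iff inv_into_into, metis f_inv_into_f)
    have ei_e: "ei (e i) = i" if "i < N" for i
      using e that unfolding N_def ei_def bij_betw_def by simp
    let ?act = "\<lambda>i j. ei (e i \<otimes>\<^bsub>G\<^esub> e j)"
    have act: "?act i j < N" if "i < N" "j < N" for i j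
      using ei e_carrier that by simp
    \<comment> \<open>Letter \<open>j\<close> will act as a preimage of \<open>e j\<close> under
      \<open>h\<close>, written as a nonempty word.\<close>
    have "\<exists>u. u \<noteq> [] \<and> set u \<subseteq> {0..<m} \<and> (\<lambda>p\<in>{0..<n}. run \<delta> p u) \<in> H \<and>
        h (\<lambda>p\<in>{0..<n}. run \<delta> p u) = e j" if j: "j < N" for j
    proof -
      obtain x where x: "x \<in> H" "h x = e j" using onto e_carrier[OF j] by (metis imageE)
      obtain u where "u \<noteq> []" "set u \<subseteq> {0..<m}" "x = (\<lambda>p\<in>{0..<n}. run \<delta> p u)"
        by (rule nonempty_word[OF assms(2) sub grp y x(1)])
      then show ?thesis using x by blast
    qed
    then obtain w where w: "\<And>j. j < N \<Longrightarrow> w j \<noteq> [] \<and> set (w j) \<subseteq> {0..<m}"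
      and wH: "\<And>j. j < N \<Longrightarrow> (\<lambda>p\<in>{0..<n}. run \<delta> p (w j)) \<in> H"
      and hw: "\<And>j. j < N \<Longrightarrow> h (\<lambda>p\<in>{0..<n}. run \<delta> p (w j)) = e j"
      by metis
    \<comment> \<open>Letter \<open>j\<close> acts on \<open>H\<close> as right multiplication by
      the transformation of \<open>w j\<close>. That transformation is restricted to
      \<open>{0..<n}\<close>, which is where \<open>x\<close> takes its values.\<close>
    have actH: "(\<lambda>p\<in>{0..<n}. run \<delta> (x p) (w j)) = tm_mult n x (\<lambda>p\<in>{0..<n}. run \<delta> p (w j))"
      if "x \<in> H" for x j
      using that HE unfolding tm_mult_def compose_def by (intro restrict_ext) (auto simp: PiE_iff)
    have actH_in: "(\<lambda>p\<in>{0..<n}. run \<delta> (x p) (w j)) \<in> H" if "x \<in> H" "j < N" for x j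
      using actH H_mult wH that by simp
    have h_act: "h (\<lambda>p\<in>{0..<n}. run \<delta> (x p) (w j)) = h x \<otimes>\<^bsub>G\<^esub> e j" if "x \<in> H" "j < N" for x j
      using actH h_mult wH hw that by simp
    have "Gamma_aut C N N ?act"
      unfolding Gamma_aut_def
    proof (intro ballI allI impI)
      fix A D f assume A: "A \<in> ob C" and D: "D \<in> ob C" and f: "homc C f (prd C (pw C A N) D) A"
      interpret conway_term C A D N f by unfold_locales (fact assms(1), fact A, fact D, fact f)
      let ?z = "dag C A D (f \<cdot> cross C (diag C A N) (ident C D))"
      let ?F = "fQ C N N ?act A D f"
      obtain sH where sH: "solves H (\<lambda>x j. \<lambda>p\<in>{0..<n}. run \<delta> (x p) (w j)) sH"
        using solves_ex[where act = "\<lambda>x j. \<lambda>p\<in>{0..<n}. run \<delta> (x p) (w j)", OF finH actH_in] by blast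
      have act': "\<forall>i<N. \<forall>j<N. ?act i j < N" using act by simp
      have F: "?F : pw C A N \<boxtimes> D \<leadsto> pw C A N" by (rule fQ_hom(1)[OF A D f act'])
      have z: "?z : D \<leadsto> A" by (rule dag_hom[OF diag_cross_pair(1)[OF A D f] A D])
      show "dag C (pw C A N) D ?F = diag C A N \<cdot> ?z"
      proof (rule power_eqI[OF power_pw[OF A] dag_hom[OF F pw_ob[OF A] D] comp_hom[OF diag_hom[OF A] z]])
        fix i assume "i \<in> {0..<N}"
        then have i: "i < N" by simp
        \<comment> \<open>Surjectivity of \<open>h\<close> puts an element of \<open>H\<close> over
          every state \<open>i\<close>. The value \<open>sH x\<close> is then the middle term
          between the two sides at \<open>i\<close>.\<close>
        obtain x where x: "x \<in> H" "h x = e i" using onto e_carrier[OF i] by (metis imageE)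
        have "sH x = (\<lambda>i. proj C A N i \<cdot> dag C (pw C A N) D ?F) ((\<lambda>x. ei (h x)) x)"
        proof (rule Gamma_init_transformations[where h = "\<lambda>x. ei (h x)",
              OF assms(2,3,4,5) w HE sH _ _ solves_fQ[OF act'] _ _ x(1)])
          have "h x \<in> carrier G" if "x \<in> H" for x using onto that by blast
          then show "ei (h x) \<in> {0..<N}" "j < N \<Longrightarrow> ei (h (\<lambda>p\<in>{0..<n}. run \<delta> (x p) (w j))) = ?act (ei (h x)) j"
            if "x \<in> H" for x j
            using ei h_act that by simp_all
        qed (use act in simp_all)
        moreover have "sH x = (\<lambda>_. ?z) ((\<lambda>_. ()) x)"
          by (rule Gamma_init_transformations[where h = "\<lambda>_. ()",
                OF assms(2,3,4,5) w HE sH _ _ solves_diag _ _ x(1)]) simp_all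
        moreover have "proj C A N i \<cdot> diag C A N \<cdot> ?z = ?z"
          unfolding diag_comp[OF A z]
          using proj_tup[of A D N "\<lambda>_. ?z" i] A D z i by simp
        ultimately show "proj C A N i \<cdot> dag C (pw C A N) D ?F = proj C A N i \<cdot> diag C A N \<cdot> ?z"
          using x(2) ei_e[OF i] by simp
      qed
    qed
    then show "Gamma_aut C (card (carrier G)) (card (carrier G))
        (\<lambda>i j. inv_into {0..<card (carrier G)} e (e i \<otimes>\<^bsub>G\<^esub> e j))"
      unfolding N_def ei_def .
  qed
qed

end
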